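(* Let $E$ be a universally complete Archimedean complex vector lattice with multiplicative identity $e$, and assume that $S(z):=\sum_{n=0}^{\infty}a_nz^n$ (with $a_n\in E$) is a power series on $E$ with radius of convergence $e$. Suppose $\sum_{n=0}^{\infty}a_n$ converges in order. Then for any sequence $(z_k)_{k\geq 0}$ in $E$ such that (i) $z_k\to e$ in order, (ii) for each $k\in\mathbb{N}_0$ we have $|z_k|\ll e$, and (iii) the set $\left\{|e-z_k|(e-|z_k|)^{-1}:k\in\mathbb{N}_0\right\}$ is order bounded, we have $S(z_k)\to S(e)$ in order.
   Context: Complex vector lattices. An Archimedean real vector lattice $F$ is square mean closed if $f\boxplus g:=\sup\{(\cos\theta)f+(\sin\theta)g:\theta\in[0,2\pi]\}$ exists in $F$ for all $f,g\in F$. An Archimedean complex vector lattice is a complexification $E=E_\rho\oplus iE_\rho$ of a square mean closed Archimedean real vector lattice $E_\rho$ (its real part), with modulus $|f+ig|:=f\boxplus g$ for $f,g\in E_\rho$. Its positive cone is $E_+=\{f\in E:|f|=f\}$, which is also the positive cone of $E_\rho$; order relations, suprema and infima are taken in $E_\rho$. $E$ is universally complete if $E_\rho$ is, i.e. $E_\rho$ is Dedekind complete and every set of pairwise disjoint positive elements has a supremum (such $E_\rho$ is automatically square mean closed). $\mathbb{N}_0=\{0,1,2,\dots\}$. Multiplication. Every universally complete Archimedean real vector lattice is a $\Phi$-algebra, i.e. an $f$-algebra with a multiplicative identity. The multiplication of $E_\rho$ is extended canonically (complex bilinearly) to $E$, written by juxtaposition; $e$ denotes the multiplicative identity and $a^0=e$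 for all $a\in E$. The relation $\ll$. A weak order unit in a real vector lattice is a positive element $u$ such that $u\wedge|x|=0$ implies $x=0$. For $x,y\in E_\rho$, $x\ll y$ means that $(y-x)^+$ is a weak order unit in $E_\rho$; when $E$ is universally complete this is equivalent to $x\le y$ and $y-x$ invertible, so $(e-|z_k|)^{-1}$ exists under (ii). Convergence. A sequence $(x_n)_{n\ge 0}$ in $E$ converges in order to $x\in E$ (written $x_n\to x$) if there is a decreasing sequence $(p_n)_{n\geq 0}$ in $E_+$ with $\inf_n p_n=0$ (written $p_n\downarrow 0$) and $|x_n-x|\le p_n$ for all $n$. A series converges in order if its sequence of partial sums converges in order in $E$. Power series. A power series on $E$ centered at $c\in E$ is a series $S(z)=\sum_{n=0}^\infty a_n(z-c)^n$ with $a_n\in E$ and $z$ a variable in $E$ (here $c=0$). It converges uniformly in order on $D\subseteq E$ if there is a sequence $p_m\downarrow 0$ with $\sup_{z\in D}\left|\sum_{n=0}^m a_n(z-c)^n-S(z)\right|\le p_m$ for every $m\ge 0$ (where $S(z)$ denotes the order sum). For $r\in E_+$ put $\bar\Delta(c,r):=\{z\in E:|z-c|\le r\}$ and $\Omega_S:=\{r\in E_+: S(z)\text{ converges uniformly in order on }\bar\Delta(c,r)\}$. If $\Omega_S$ is order bounded, then $\rho_S:=\sup\Omega_S$ is called the radius of convergence of $S$; "radius of convergence $e$" means that $\Omega_S$ is order bounded and $\rho_S=e$. *)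

theory Defs
  imports Complex_Main "HOL-Library.Lattice_Algebras" "HOL-Library.Lub_Glb"
begin

section \<open>Vector lattices and f-algebras\<close>

class vector_lattice = ordered_real_vector + lattice_ab_group_add_abs

class archimedean_vector_lattice = vector_lattice +
  assumes archimedean_property: "(\<And>n::nat. real n *\<^sub>R x \<le> y) \<Longrightarrow> x \<le> 0"

text \<open>
  Dedekind completeness is \<^class>\<open>conditionally_complete_lattice\<close>. The empty family has to be
  excluded in the lateral completeness axiom: its supremum in the whole lattice would be
  a least element.
\<close>

class universally_complete_vector_lattice =
  archimedean_vector_lattice + conditionally_complete_lattice +
  assumes laterally_complete:
    "A \<noteq> {} \<Longrightarrow> (\<And>x. x \<in> A \<Longrightarrow> 0 \<le> x) \<Longrightarrow>
     (\<And>x y. x \<in> A \<Longrightarrow> y \<in> A \<Longrightarrow> x \<noteq> y \<Longrightarrow> inf x y = 0) \<Longrightarrow>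
     \<exists>s. (\<forall>x\<in>A. x \<le> s) \<and> (\<forall>u. (\<forall>x\<in>A. x \<le> u) \<longrightarrow> s \<le> u)"

class f_algebra = vector_lattice + lattice_ring + real_algebra +
  assumes f_algebra_right: "inf a b = 0 \<Longrightarrow> 0 \<le> c \<Longrightarrow> inf (a * c) b = 0"
    and f_algebra_left: "inf a b = 0 \<Longrightarrow> 0 \<le> c \<Longrightarrow> inf (c * a) b = 0"

text \<open>
  The unit is taken from \<^class>\<open>monoid_mult\<close> rather than \<^class>\<open>ring_1\<close>, so that the zero
  space is not excluded.
\<close>

class phi_algebra = f_algebra + monoid_mult

text \<open>
  The f-algebra product of a universally complete vector lattice is unique only up to the choice
  of the unit (an arbitrary weak order unit). Statements about the sort below hold for every such
  choice.
\<close>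

class universally_complete_phi_algebra = universally_complete_vector_lattice + phi_algebra

definition weak_order_unit :: "'a::vector_lattice \<Rightarrow> bool" where
  "weak_order_unit u \<longleftrightarrow> 0 \<le> u \<and> (\<forall>x. inf u \<bar>x\<bar> = 0 \<longrightarrow> x = 0)"

definition much_less :: "'a::vector_lattice \<Rightarrow> 'a \<Rightarrow> bool" (infix "\<lless>" 50) where
  "x \<lless> y \<longleftrightarrow> weak_order_unit (pprt (y - x))"

definition order_bounded :: "'a::order set \<Rightarrow> bool" where
  "order_bounded A \<longleftrightarrow> bdd_below A \<and> bdd_above A"

text \<open>Only meaningful if \<^term>\<open>x\<close> is invertible; the inverse is then unique.\<close>

definition mult_inverse :: "'a::monoid_mult \<Rightarrow> 'a" where
  "mult_inverse x = (THE y. x * y = 1 \<and> y * x = 1)"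

lemma mult_inverse_eq:
  fixes x :: "'a::monoid_mult"
  assumes "x * y = 1" and "y * x = 1"
  shows "mult_inverse x = y"
  unfolding mult_inverse_def
proof (rule the_equality)
  fix z assume "x * z = 1 \<and> z * x = 1"
  then have "z = z * (x * y)" using assms by simp
  also have "\<dots> = (z * x) * y" by (simp only: mult.assoc)
  also have "\<dots> = y" using \<open>x * z = 1 \<and> z * x = 1\<close> by simp
  finally show "z = y" .
qed (use assms in simp)

section \<open>Complexification\<close>

datatype 'a complexification = Complexify (re_part: 'a) (im_part: 'a)

instantiation complexification :: (ab_group_add) ab_group_add
begin
definition "0 = Complexify 0 0"
definition "z + w = Complexify (re_part z + re_part w) (im_part z + im_part w)"
definition "- z = Complexify (- re_part z) (- im_part z)"
definition "z - w = Complexify (re_part z - re_part w) (im_part z - im_part w)"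
instance
  by standard (auto simp: zero_complexification_def plus_complexification_def
      uminus_complexification_def minus_complexification_def algebra_simps
      intro: complexification.expand)
end

instantiation complexification :: (ring) ring
begin
definition "z * w = Complexify (re_part z * re_part w - im_part z * im_part w)
                               (re_part z * im_part w + im_part z * re_part w)"
instance
  by standard (simp_all add: times_complexification_def plus_complexification_def algebra_simps)
end

instantiation complexification :: ("{ring, monoid_mult}") monoid_mult
begin
definition "1 = Complexify 1 0"
instance
  by standard (simp_all add: times_complexification_def one_complexification_def)
end

definition square_mean ::
    "'a::{vector_lattice, conditionally_complete_lattice} \<Rightarrow> 'a \<Rightarrow> 'a" (infixl "\<boxplus>" 65) where
  "f \<boxplus> g = (SUP \<theta>\<in>{0..2 * pi}. cos \<theta> *\<^sub>R f + sin \<theta> *\<^sub>R g)"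

lemma scaleR_le_abs:
  fixes f :: "'a::vector_lattice"
  assumes "\<bar>c\<bar> \<le> 1"
  shows "c *\<^sub>R f \<le> \<bar>f\<bar>"
proof (cases "0 \<le> c")
  case True
  then have "c *\<^sub>R f \<le> c *\<^sub>R \<bar>f\<bar>" by (intro scaleR_left_mono abs_ge_self)
  also have "\<dots> \<le> 1 *\<^sub>R \<bar>f\<bar>" using assms by (intro scaleR_right_mono) auto
  finally show ?thesis by simp
next
  case False
  then have "(- c) *\<^sub>R (- f) \<le> (- c) *\<^sub>R \<bar>f\<bar>" by (intro scaleR_left_mono abs_ge_minus_self) auto
  also have "\<dots> \<le> 1 *\<^sub>R \<bar>f\<bar>" using assms by (intro scaleR_right_mono) auto
  finally show ?thesis by simp
qed

text \<open>Dedekind completeness implies that the real part is square mean closed.\<close>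

lemma bdd_above_square_mean:
  fixes f g :: "'a::{vector_lattice, conditionally_complete_lattice}"
  shows "bdd_above ((\<lambda>\<theta>. cos \<theta> *\<^sub>R f + sin \<theta> *\<^sub>R g) ` {0..2 * pi})"
  by (rule bdd_aboveI2[where M = "\<bar>f\<bar> + \<bar>g\<bar>"]) (intro add_mono scaleR_le_abs; simp)

lemma square_mean_isLub:
  fixes f g :: "'a::{vector_lattice, conditionally_complete_lattice}"
  shows "isLub UNIV ((\<lambda>\<theta>. cos \<theta> *\<^sub>R f + sin \<theta> *\<^sub>R g) ` {0..2 * pi}) (f \<boxplus> g)"
  unfolding isLub_def leastP_def isUb_def setle_def setge_def square_mean_def
  by (auto intro!: cSUP_upper cSUP_least bdd_above_square_mean)

text \<open>
  The modulus takes its values in the real part. Accordingly, the positive cone of the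
  complexification is represented by the nonnegative elements of the real part.
\<close>

definition modulus ::
    "'a::{vector_lattice, conditionally_complete_lattice} complexification \<Rightarrow> 'a" where
  "modulus z = re_part z \<boxplus> im_part z"

section \<open>Order convergence\<close>

definition decreases_to_zero :: "(nat \<Rightarrow> 'a::{vector_lattice, conditionally_complete_lattice}) \<Rightarrow> bool"
  where "decreases_to_zero p \<longleftrightarrow> decseq p \<and> (\<forall>n. 0 \<le> p n) \<and> (INF n. p n) = 0"

definition order_converges ::
    "(nat \<Rightarrow> 'a::{vector_lattice, conditionally_complete_lattice} complexification)
      \<Rightarrow> 'a complexification \<Rightarrow> bool" where
  "order_converges x l \<longleftrightarrow> (\<exists>p. decreases_to_zero p \<and> (\<forall>n. modulus (x n - l) \<le> p n))"

definition order_sums ::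
    "(nat \<Rightarrow> 'a::{vector_lattice, conditionally_complete_lattice} complexification)
      \<Rightarrow> 'a complexification \<Rightarrow> bool" where
  "order_sums x s \<longleftrightarrow> order_converges (\<lambda>m. \<Sum>n\<le>m. x n) s"

definition order_summable ::
    "(nat \<Rightarrow> 'a::{vector_lattice, conditionally_complete_lattice} complexification) \<Rightarrow> bool" where
  "order_summable x \<longleftrightarrow> (\<exists>s. order_sums x s)"

definition order_suminf ::
    "(nat \<Rightarrow> 'a::{vector_lattice, conditionally_complete_lattice} complexification)
      \<Rightarrow> 'a complexification" where
  "order_suminf x = (THE s. order_sums x s)"

lemma abs_re_part_le_modulus: "\<bar>re_part z\<bar> \<le> modulus z"
proof (rule abs_leI)
  have "cos 0 *\<^sub>R re_part z + sin 0 *\<^sub>R im_part z \<le> modulus z"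
    unfolding modulus_def square_mean_def by (rule cSUP_upper[OF _ bdd_above_square_mean]) simp
  then show "re_part z \<le> modulus z" by simp
  have "cos pi *\<^sub>R re_part z + sin pi *\<^sub>R im_part z \<le> modulus z"
    unfolding modulus_def square_mean_def by (rule cSUP_upper[OF _ bdd_above_square_mean]) simp
  then show "- re_part z \<le> modulus z" by simp
qed

lemma abs_im_part_le_modulus: "\<bar>im_part z\<bar> \<le> modulus z"
proof (rule abs_leI)
  have "cos (pi/2) *\<^sub>R re_part z + sin (pi/2) *\<^sub>R im_part z \<le> modulus z"
    unfolding modulus_def square_mean_def by (rule cSUP_upper[OF _ bdd_above_square_mean]) simp
  then show "im_part z \<le> modulus z" by simp
  have "cos (3/2*pi) *\<^sub>R re_part z + sin (3/2*pi) *\<^sub>R im_part z \<le> modulus z"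
    unfolding modulus_def square_mean_def by (rule cSUP_upper[OF _ bdd_above_square_mean]) simp
  then show "- im_part z \<le> modulus z" unfolding cos_3over2_pi sin_3over2_pi by simp
qed

lemma decreases_to_zero_add_le:
  fixes p :: "nat \<Rightarrow> 'a::{vector_lattice, conditionally_complete_lattice}"
  assumes p: "decreases_to_zero p" and q: "decreases_to_zero q"
    and le: "\<And>n. c \<le> p n + q n"
  shows "c \<le> 0"
proof -
  have "c - p m \<le> q n" for m n
  proof -
    have "c \<le> p (max m n) + q (max m n)" by (rule le)
    also have "\<dots> \<le> p m + q n"
      using p q by (intro add_mono) (auto simp: decreases_to_zero_def intro: decseqD)
    finally show ?thesis by (simp add: diff_le_eq add.commute)
  qed
  then have "c - p m \<le> (INF n. q n)" for m by (intro cINF_greatest) auto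
  then have "c \<le> p m" for m using q by (simp add: decreases_to_zero_def)
  then have "c \<le> (INF n. p n)" by (intro cINF_greatest) auto
  then show ?thesis using p by (simp add: decreases_to_zero_def)
qed

lemma order_converges_unique:
  assumes s: "order_converges x s" and t: "order_converges x t"
  shows "s = t"
proof -
  obtain p where p: "decreases_to_zero p" "\<And>n. modulus (x n - s) \<le> p n"
    using s unfolding order_converges_def by blast
  obtain q where q: "decreases_to_zero q" "\<And>n. modulus (x n - t) \<le> q n"
    using t unfolding order_converges_def by blast
  have tri: "\<bar>b - c\<bar> \<le> \<bar>a - b\<bar> + \<bar>a - c\<bar>" for a b c :: 'a
    using abs_triangle_ineq[of "b - a" "a - c"] by (simp add: abs_minus_commute)
  have "\<bar>re_part s - re_part t\<bar> \<le> p n + q n" for n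
  proof -
    have "\<bar>re_part (x n - s)\<bar> + \<bar>re_part (x n - t)\<bar> \<le> p n + q n"
      by (intro add_mono order_trans[OF abs_re_part_le_modulus] p(2) q(2))
    then show ?thesis
      using tri[of "re_part s" "re_part t" "re_part (x n)"]
      by (simp add: minus_complexification_def)
  qed
  then have re: "\<bar>re_part s - re_part t\<bar> \<le> 0" by (rule decreases_to_zero_add_le[OF p(1) q(1)])
  have "\<bar>im_part s - im_part t\<bar> \<le> p n + q n" for n
  proof -
    have "\<bar>im_part (x n - s)\<bar> + \<bar>im_part (x n - t)\<bar> \<le> p n + q n"
      by (intro add_mono order_trans[OF abs_im_part_le_modulus] p(2) q(2))
    then show ?thesis
      using tri[of "im_part s" "im_part t" "im_part (x n)"]
      by (simp add: minus_complexification_def)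
  qed
  then have im: "\<bar>im_part s - im_part t\<bar> \<le> 0" by (rule decreases_to_zero_add_le[OF p(1) q(1)])
  show ?thesis using re im by (intro complexification.expand) simp
qed

lemma order_suminf_eq: "order_sums x s \<Longrightarrow> order_suminf x = s"
  unfolding order_suminf_def order_sums_def by (blast intro: order_converges_unique)

section \<open>Power series\<close>

definition power_series_term ::
    "(nat \<Rightarrow> 'a::universally_complete_phi_algebra complexification)
      \<Rightarrow> 'a complexification \<Rightarrow> 'a complexification \<Rightarrow> nat \<Rightarrow> 'a complexification" where
  "power_series_term a c z n = a n * (z - c) ^ n"

definition power_series ::
    "(nat \<Rightarrow> 'a::universally_complete_phi_algebra complexification)
      \<Rightarrow> 'a complexification \<Rightarrow> 'a complexification \<Rightarrow> 'a complexification" where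
  "power_series a c z = order_suminf (power_series_term a c z)"

text \<open>
  The last conjunct includes the existence of the supremum; it is intended for nonempty
  \<^term>\<open>D\<close>, such as the closed discs below.
\<close>

definition converges_uniformly_in_order ::
    "(nat \<Rightarrow> 'a::universally_complete_phi_algebra complexification)
      \<Rightarrow> 'a complexification \<Rightarrow> 'a complexification set \<Rightarrow> bool" where
  "converges_uniformly_in_order a c D \<longleftrightarrow>
     (\<forall>z\<in>D. order_summable (power_series_term a c z)) \<and>
     (\<exists>p. decreases_to_zero p \<and>
       (\<forall>m. bdd_above
              ((\<lambda>z. modulus ((\<Sum>n\<le>m. power_series_term a c z n) - power_series a c z)) ` D) \<and>
            (SUP z\<in>D. modulus ((\<Sum>n\<le>m. power_series_term a c z n) - power_series a c z)) \<le> p m))"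

definition closed_disc ::
    "'a::universally_complete_phi_algebra complexification \<Rightarrow> 'a \<Rightarrow> 'a complexification set" where
  "closed_disc c r = {z. modulus (z - c) \<le> r}"

definition uniform_radii ::
    "(nat \<Rightarrow> 'a::universally_complete_phi_algebra complexification)
      \<Rightarrow> 'a complexification \<Rightarrow> 'a set" where
  "uniform_radii a c = {r. 0 \<le> r \<and> converges_uniformly_in_order a c (closed_disc c r)}"

definition has_radius_of_convergence ::
    "(nat \<Rightarrow> 'a::universally_complete_phi_algebra complexification)
      \<Rightarrow> 'a complexification \<Rightarrow> 'a \<Rightarrow> bool" where
  "has_radius_of_convergence a c r \<longleftrightarrow>
     order_bounded (uniform_radii a c) \<and> Sup (uniform_radii a c) = r"

end

theory Submission
  imports Defs
begin

text \<open>
  The classical proof of Abel's limit theorem survives in an f-algebra once each of its steps is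
  written as an inequality between moduli. Let \<open>s\<close> be the order sum of the coefficients and
  \<open>p\<^sub>n \<down> 0\<close> a bound for the moduli of the differences between partial sums and \<open>s\<close>. Summation by
  parts (\<open>summation_by_parts_power\<close>) expresses the partial sum of the series at \<open>z\<close>, minus \<open>s\<close>, as
  \<open>1 - z\<close> times a sum of the terms \<open>(s\<^sub>n - s) z\<^sup>n\<close>, plus a remainder that vanishes in order.
  Splitting that sum at an index \<open>N\<close> and bounding the geometric sums by the inverse of
  \<open>1 - |z|\<close> gives \<open>abel_estimate\<close>; in the limit,

    \<open>|S(z\<^sub>k) - s| \<le> N p\<^sub>0 q\<^sub>k + c p\<^sub>N\<close>  for all \<open>N\<close> and \<open>k\<close>,

  where \<open>q\<^sub>k \<down> 0\<close> dominates \<open>|1 - z\<^sub>k|\<close> and \<open>c\<close> bounds the products \<open>|1 - z\<^sub>k| (1 - |z\<^sub>k|)\<inverse>\<close>. The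
  infimum over \<open>N\<close> of the right-hand side decreases to zero as \<open>k\<close> grows, because multiplication is
  order continuous (\<open>decreases_to_zero_mult_left\<close>).

  The algebra behind these inequalities has to be derived from the axioms of an f-algebra,
  without a representation by functions. Three facts carry it.

  The product is commutative (\<open>phi_algebra_commute\<close>). Where \<open>n b\<close> is close to the integer \<open>k\<close>, the
  commutator of \<open>a \<ge> 0\<close> with \<open>n b\<close> is that of \<open>a\<close> with the small element \<open>n b - k\<close>, hence at most
  \<open>2 a\<close>. For \<open>b \<ge> 0\<close> these regions cover everything, so \<open>n |a b - b a| \<le> 2 a\<close> for every \<open>n\<close>.

  The modulus is submultiplicative (\<open>modulus_mult_le\<close>). The modulus is defined as a supremum of
  rotations; the essential point is that an upper bound \<open>p\<close> of all rotations of \<open>(a, b)\<close> satisfies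
  \<open>a\<^sup>2 + b\<^sup>2 \<le> p\<^sup>2\<close>. This is proved by repeated squaring of \<open>a + i b\<close>: doubling the angle improves
  any such inequality that holds up to a constant factor, and the factors tend to one.

  A weak order unit \<open>1 - x\<close> with \<open>0 \<le> x \<le> 1\<close> is invertible, and its inverse bounds all partial sums
  of the geometric series in \<open>x\<close> (\<open>one_minus_invertible\<close>). The unit is exhausted by disjoint pieces
  on which \<open>1 - x\<close> is bounded below by a positive number, and lateral completeness glues the bounds
  found on the pieces.
\<close>

section \<open>Disjointness in Archimedean vector lattices\<close>

lemma disjoint_mono:
  fixes t x y :: "'a::lattice_ab_group_add"
  assumes "inf t y = 0" "0 \<le> x" "x \<le> y"
  shows "inf t x = 0"
proof (rule antisym)
  show "inf t x \<le> 0" using assms(1,3) by (metis inf_mono order_refl)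
  show "0 \<le> inf t x" using assms(1,2) by (metis inf.cobounded1 le_inf_iff)
qed

lemma disjoint_add:
  fixes t x y :: "'a::lattice_ab_group_add"
  assumes x: "inf t x = 0" and y: "inf t y = 0"
  shows "inf t (x + y) = 0"
proof -
  have nonneg: "0 \<le> t" "0 \<le> x" "0 \<le> y"
    using x y by (metis inf.cobounded1 inf.cobounded2)+
  define s where "s = inf t (x + y)"
  have "s - x \<le> inf t y"
    using nonneg unfolding s_def
    by (intro le_infI) (simp_all add: diff_le_eq add_increasing2 le_infI1 le_infI2 add.commute)
  then have "s \<le> inf t x" unfolding y s_def by simp
  then have "s \<le> 0" using x by simp
  moreover have "0 \<le> s" using nonneg by (simp add: s_def)
  ultimately show ?thesis by (metis antisym s_def)
qed

lemma disjoint_scaleR_of_nat: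
  fixes t x :: "'a::vector_lattice"
  assumes "inf t x = 0"
  shows "inf t (real n *\<^sub>R x) = 0"
proof (induction n)
  case 0
  have "0 \<le> t" using assms by (metis inf.cobounded1)
  then show ?case by (simp add: inf_absorb2)
next
  case (Suc n)
  then show ?case using disjoint_add[OF assms Suc] by (simp add: scaleR_add_left)
qed

lemma disjoint_pprt_pprt_minus:
  fixes x :: "'a::lattice_ab_group_add"
  shows "inf (pprt x) (pprt (- x)) = 0"
proof -
  have "inf (pprt x) (pprt (- x)) = inf (x + - nprt x) (0 + - nprt x)"
    using prts[of x] by (simp only: pprt_neg add_0_left)
      (metis add_diff_cancel_right' diff_conv_add_uminus)
  also have "\<dots> = 0"
    by (simp only: add_inf_distrib_right[symmetric] nprt_def add.right_inverse)
  finally show ?thesis .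
qed

lemma abs_add_self:
  fixes x :: "'a::lattice_ab_group_add_abs"
  shows "\<bar>x\<bar> + x = pprt x + pprt x"
proof -
  have "\<bar>x\<bar> + (pprt x + nprt x) = pprt x + pprt x" by (simp add: abs_prts)
  then show ?thesis by (simp only: prts[symmetric])
qed

lemma abs_scaleR_nonneg:
  fixes x :: "'a::vector_lattice"
  assumes "0 \<le> c"
  shows "\<bar>c *\<^sub>R x\<bar> = c *\<^sub>R \<bar>x\<bar>"
proof -
  have le: "\<bar>b *\<^sub>R y\<bar> \<le> b *\<^sub>R \<bar>y\<bar>" if "0 \<le> b" for b and y :: 'a
  proof (rule abs_leI)
    show "b *\<^sub>R y \<le> b *\<^sub>R \<bar>y\<bar>" using that by (intro scaleR_left_mono abs_ge_self)
    have "b *\<^sub>R (- y) \<le> b *\<^sub>R \<bar>y\<bar>" using that by (intro scaleR_left_mono abs_ge_minus_self)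
    then show "- (b *\<^sub>R y) \<le> b *\<^sub>R \<bar>y\<bar>" by simp
  qed
  show ?thesis
  proof (cases "c = 0")
    case False
    then have "c *\<^sub>R \<bar>inverse c *\<^sub>R (c *\<^sub>R x)\<bar> \<le> c *\<^sub>R (inverse c *\<^sub>R \<bar>c *\<^sub>R x\<bar>)"
      using assms by (intro scaleR_left_mono le) auto
    then have "c *\<^sub>R \<bar>x\<bar> \<le> \<bar>c *\<^sub>R x\<bar>" using False by simp
    then show ?thesis using le[OF assms] by (intro antisym)
  qed simp
qed

text \<open>
  For functions: where both \<open>t\<close> and \<open>x\<close> are positive, some multiple of \<open>x\<close> exceeds \<open>y\<close>. In the
  lattice, \<open>s = inf t x\<close> satisfies \<open>n s \<le> y\<close> for all \<open>n\<close>, since the excess of \<open>n s\<close> over \<open>y\<close> lies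
  below \<open>n t\<close> and is disjoint from \<open>t\<close>.
\<close>

lemma disjoint_if_disjoint_pprt_multiples:
  fixes t x y :: "'a::archimedean_vector_lattice"
  assumes "0 \<le> t" "0 \<le> x" "0 \<le> y"
    and disj: "\<And>n::nat. inf t (pprt (real n *\<^sub>R x - y)) = 0"
  shows "inf t x = 0"
proof -
  define s where "s = inf t x"
  have s: "0 \<le> s" "s \<le> t" "s \<le> x" using assms by (simp_all add: s_def)
  have "real n *\<^sub>R s \<le> y" for n
  proof -
    define g where "g = pprt (real n *\<^sub>R x - y)"
    have "inf g s = 0"
      using disjoint_mono[of g t s] disj[of n] s by (simp add: g_def inf_commute)
    then have "inf g (real n *\<^sub>R s) = 0" by (rule disjoint_scaleR_of_nat)
    moreover have "pprt (real n *\<^sub>R s - y) \<le> g"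
      unfolding g_def using s by (intro pprt_mono diff_right_mono scaleR_left_mono) auto
    moreover have "pprt (real n *\<^sub>R s - y) \<le> real n *\<^sub>R s"
      using s \<open>0 \<le> y\<close> by (simp add: pprt_def scaleR_nonneg_nonneg)
    ultimately have "pprt (real n *\<^sub>R s - y) \<le> 0" by (metis le_infI)
    then have "real n *\<^sub>R s - y \<le> 0" by (simp add: pprt_def)
    then show ?thesis by simp
  qed
  then have "s \<le> 0" by (rule archimedean_property)
  then show ?thesis using s by (simp add: s_def antisym)
qed

section \<open>Products of disjoint elements and squares\<close>

lemma disjoint_mult_right:
  fixes t x c :: "'a::f_algebra"
  shows "inf t x = 0 \<Longrightarrow> 0 \<le> c \<Longrightarrow> inf t (x * c) = 0"
  using f_algebra_right[of x t c] by (simp add: inf_commute)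

lemma disjoint_mult_left:
  fixes t x c :: "'a::f_algebra"
  shows "inf t x = 0 \<Longrightarrow> 0 \<le> c \<Longrightarrow> inf t (c * x) = 0"
  using f_algebra_left[of x t c] by (simp add: inf_commute)

text \<open>
  Multiplying one factor and then the other keeps the pair disjoint, so the product is disjoint
  from itself.
\<close>

lemma disjoint_imp_mult_eq_0:
  fixes x y :: "'a::f_algebra"
  assumes "inf x y = 0"
  shows "x * y = 0"
proof -
  have "0 \<le> x" "0 \<le> y" using assms by (metis inf.cobounded1 inf.cobounded2)+
  have "inf y (x * y) = 0"
    using assms \<open>0 \<le> y\<close> by (metis disjoint_mult_right inf_commute)
  then have "inf (x * y) (x * y) = 0"
    using \<open>0 \<le> x\<close> by (metis disjoint_mult_left inf_commute)
  then show ?thesis by simp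
qed

lemma pprt_minus_pprt_minus:
  fixes x :: "'a::lattice_ab_group_add"
  shows "pprt x - pprt (- x) = x"
  using prts[of x] by (simp add: pprt_neg)

lemma square_nonneg:
  fixes x :: "'a::f_algebra"
  shows "0 \<le> x * x"
proof -
  have "pprt x * pprt (- x) = 0"
    by (intro disjoint_imp_mult_eq_0 disjoint_pprt_pprt_minus)
  moreover have "pprt (- x) * pprt x = 0"
    using disjoint_pprt_pprt_minus[of "- x"] by (intro disjoint_imp_mult_eq_0) simp
  ultimately have "(pprt x - pprt (- x)) * (pprt x - pprt (- x)) =
      pprt x * pprt x + pprt (- x) * pprt (- x)"
    by (simp add: algebra_simps del: pprt_eq_id)
  then have "x * x = pprt x * pprt x + pprt (- x) * pprt (- x)"
    by (simp only: pprt_minus_pprt_minus)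
  then show ?thesis by simp
qed

lemma one_nonneg: "(0::'a::phi_algebra) \<le> 1"
  using square_nonneg[of "1::'a"] by simp

lemma disjoint_one_imp_eq_0:
  fixes x :: "'a::phi_algebra"
  assumes "inf x 1 = 0"
  shows "x = 0"
  using disjoint_imp_mult_eq_0[OF assms] by simp

section \<open>Commutativity of Archimedean f-algebras with unit\<close>

text \<open>
  A localized estimate: on the region where \<open>|x| < 1\<close> the commutator with \<open>a\<close> is at most \<open>2 a\<close>. The
  reason is that \<open>|x| \<le> 1 + y\<close> with \<open>y\<close> disjoint from that region, and products with \<open>y\<close> remain
  disjoint from it.
\<close>

lemma commutator_disjoint:
  fixes a x :: "'a::phi_algebra"
  assumes "0 \<le> a"
  shows "inf (pprt (\<bar>a * x - x * a\<bar> - (a + a))) (pprt (1 - \<bar>x\<bar>)) = 0"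
proof -
  define w where "w = pprt (\<bar>a * x - x * a\<bar> - (a + a))"
  define t where "t = inf w (pprt (1 - \<bar>x\<bar>))"
  define y where "y = pprt (\<bar>x\<bar> - 1)"
  have t: "0 \<le> t" "t \<le> w" "t \<le> pprt (1 - \<bar>x\<bar>)" by (simp_all add: t_def w_def)
  have y: "0 \<le> y" "\<bar>x\<bar> \<le> 1 + y"
    by (simp_all add: y_def pprt_def add_sup_distrib_left)
  have "inf y t = 0"
    using disjoint_mono[OF _ t(1,3), of y] disjoint_pprt_pprt_minus[of "\<bar>x\<bar> - 1"]
    by (simp add: y_def)
  then have ty: "inf t (a * y + y * a) = 0"
    using assms by (intro disjoint_add disjoint_mult_left disjoint_mult_right)
      (simp_all add: inf_commute)
  have "\<bar>a * x - x * a\<bar> \<le> \<bar>a * x\<bar> + \<bar>x * a\<bar>" by (rule abs_triangle_ineq4)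
  also have "\<dots> \<le> \<bar>a\<bar> * \<bar>x\<bar> + \<bar>x\<bar> * \<bar>a\<bar>" by (intro add_mono abs_le_mult)
  also have "\<dots> \<le> a * (1 + y) + (1 + y) * a"
    using assms y by (simp add: abs_of_nonneg add_mono mult_left_mono mult_right_mono)
  also have "\<dots> = (a + a) + (a * y + y * a)" by (simp add: algebra_simps)
  finally have "\<bar>a * x - x * a\<bar> - (a + a) \<le> a * y + y * a" by (simp add: algebra_simps)
  then have "w \<le> a * y + y * a" using assms y by (simp add: w_def pprt_def)
  then have "t \<le> inf t (a * y + y * a)" using t by simp
  then show ?thesis using ty t(1) unfolding t_def w_def by (metis antisym)
qed

text \<open>
  The excess \<open>w\<close> of \<open>n |a b - b a|\<close> over \<open>2 a\<close> vanishes where \<open>|n b - k| < 1\<close>, by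
  \<open>commutator_disjoint\<close> for \<open>n b - k\<close>. These strips, taken for the first integers \<open>k\<close>, cover the
  region \<open>n b < K\<close>, so \<open>w\<close> is disjoint from every \<open>(K - n b)\<^sup>+\<close> and hence from the unit.
\<close>

lemma phi_algebra_commute_nonneg:
  fixes a b :: "'a::{archimedean_vector_lattice, phi_algebra}"
  assumes a: "0 \<le> a" and b: "0 \<le> b"
  shows "a * b = b * a"
proof -
  have "real n *\<^sub>R \<bar>a * b - b * a\<bar> \<le> a + a" for n
  proof -
    define w where "w = pprt (real n *\<^sub>R \<bar>a * b - b * a\<bar> - (a + a))"
    have local: "inf w (pprt (1 - \<bar>real n *\<^sub>R b - real k *\<^sub>R 1\<bar>)) = 0" for k
    proof -
      define x where "x = real n *\<^sub>R b - real k *\<^sub>R (1::'a)"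
      have "a * x - x * a = real n *\<^sub>R (a * b - b * a)"
        by (simp add: x_def left_diff_distrib right_diff_distrib scaleR_diff_right)
      then have "\<bar>a * x - x * a\<bar> = real n *\<^sub>R \<bar>a * b - b * a\<bar>"
        by (simp only: abs_scaleR_nonneg[OF of_nat_0_le_iff])
      then show ?thesis using commutator_disjoint[OF a, of x] by (simp add: w_def x_def)
    qed
    have "inf w (pprt (real k *\<^sub>R 1 - real n *\<^sub>R b)) = 0" for k
    proof (induction k)
      case 0
      then show ?case using b by (simp add: scaleR_nonneg_nonneg inf_absorb2 w_def)
    next
      case (Suc k)
      define t where "t = real k *\<^sub>R 1 - real n *\<^sub>R b"
      have "\<bar>t\<bar> = \<bar>real n *\<^sub>R b - real k *\<^sub>R 1\<bar>" by (simp add: t_def abs_minus_commute)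
      then have "inf w (pprt (1 - \<bar>t\<bar>) + (pprt t + pprt t)) = 0"
        using Suc local[of k] by (intro disjoint_add) (simp_all add: t_def)
      moreover have "pprt (1 + t) \<le> pprt (1 - \<bar>t\<bar>) + (pprt t + pprt t)"
      proof -
        \<comment> \<open>The region \<open>n b < k + 1\<close> is covered by the strip around \<open>k\<close> and the region \<open>n b < k\<close>.\<close>
        have "1 + t = (1 - \<bar>t\<bar>) + (pprt t + pprt t)"
          by (simp flip: abs_add_self)
        also have "\<dots> \<le> pprt (1 - \<bar>t\<bar>) + (pprt t + pprt t)"
          by (intro add_right_mono) (simp add: pprt_def)
        finally show ?thesis by (simp add: pprt_def[of "1 + t"])
      qed
      ultimately have "inf w (pprt (1 + t)) = 0" by (rule disjoint_mono[OF _ zero_le_pprt])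
      moreover have "1 + t = real (Suc k) *\<^sub>R 1 - real n *\<^sub>R b"
        by (simp add: t_def scaleR_add_left add_diff_eq)
      ultimately show ?case by simp
    qed
    moreover have "0 \<le> w" "0 \<le> real n *\<^sub>R b" using b by (simp_all add: w_def scaleR_nonneg_nonneg)
    ultimately have "inf w 1 = 0"
      using disjoint_if_disjoint_pprt_multiples[OF _ one_nonneg] by blast
    then have "w = 0" by (rule disjoint_one_imp_eq_0)
    then show ?thesis unfolding w_def le_zero_iff_zero_pprt[symmetric] by simp
  qed
  then have "\<bar>a * b - b * a\<bar> \<le> 0" by (rule archimedean_property)
  then show ?thesis by simp
qed

lemma phi_algebra_commute:
  fixes a b :: "'a::{archimedean_vector_lattice, phi_algebra}"
  shows "a * b = b * a"
proof -
  have "(pprt a - pprt (- a)) * (pprt b - pprt (- b)) =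
        (pprt b - pprt (- b)) * (pprt a - pprt (- a))"
    by (simp add: algebra_simps phi_algebra_commute_nonneg[of "pprt _" "pprt _"])
  then show ?thesis by (simp only: pprt_minus_pprt_minus)
qed

lemma phi_algebra_left_commute:
  fixes a b c :: "'a::{archimedean_vector_lattice, phi_algebra}"
  shows "a * (b * c) = b * (a * c)"
  by (metis mult.assoc phi_algebra_commute)

lemmas phi_algebra_ac = mult.assoc phi_algebra_commute phi_algebra_left_commute

section \<open>Squares and rotations\<close>

text \<open>
  If \<open>y\<^sup>2 = 0\<close> then expanding the nonnegative square of \<open>1 - n y\<close> leaves \<open>2 n y \<le> 1\<close>.
\<close>

lemma square_eq_0_imp_eq_0:
  fixes x :: "'a::{archimedean_vector_lattice, phi_algebra}"
  assumes "x * x = 0"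
  shows "x = 0"
proof -
  have le: "y \<le> 0" if "y * y = 0" for y :: 'a
  proof -
    have "real n *\<^sub>R (y + y) \<le> 1" for n
    proof -
      have "0 \<le> (1 - real n *\<^sub>R y) * (1 - real n *\<^sub>R y)" by (rule square_nonneg)
      also have "\<dots> = 1 - real n *\<^sub>R (y + y)"
        using that by (simp add: left_diff_distrib right_diff_distrib scaleR_add_right diff_diff_eq)
      finally show ?thesis by simp
    qed
    then have "y + y \<le> 0" by (rule archimedean_property)
    then show ?thesis by simp
  qed
  have "x \<le> 0" "- x \<le> 0" using le[of x] le[of "- x"] assms by auto
  then show ?thesis by (intro antisym) auto
qed

text \<open>
  With \<open>t = (x - y)\<^sup>+\<close>, multiplying \<open>x\<^sup>2 - y\<^sup>2 \<le> 0\<close> by \<open>t\<close> turns the factor \<open>x - y\<close> into \<open>t\<close>; this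
  forces \<open>t\<^sup>3 = 0\<close>, and there are no nilpotents.
\<close>

lemma square_le_imp_le:
  fixes x y :: "'a::{archimedean_vector_lattice, phi_algebra}"
  assumes y: "0 \<le> y" and le: "x * x \<le> y * y"
  shows "x \<le> y"
proof -
  define t where "t = pprt (x - y)"
  have t: "0 \<le> t" by (simp add: t_def)
  have "t * pprt (- (x - y)) = 0"
    unfolding t_def by (intro disjoint_imp_mult_eq_0 disjoint_pprt_pprt_minus)
  then have "t * (pprt (x - y) - pprt (- (x - y))) = t * t"
    by (simp only: right_diff_distrib) (simp add: t_def)
  then have tt: "t * (x - y) = t * t" by (simp only: pprt_minus_pprt_minus)
  have "t * t * t + t * t * (y + y) = t * ((x - y) * (x + y))"
  proof -
    have "t * ((x - y) * (x + y)) = t * (x - y) * (x - y + (y + y))" by (simp add: mult.assoc)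
    also have "\<dots> = t * t * (x - y) + t * t * (y + y)" by (simp only: tt distrib_left)
    also have "t * t * (x - y) = t * t * t" by (simp only: mult.assoc tt)
    finally show ?thesis by simp
  qed
  also have "(x - y) * (x + y) = x * x - y * y"
    by (simp add: algebra_simps phi_algebra_commute[of x y])
  also have "t * (x * x - y * y) \<le> 0" using t le by (intro mult_nonneg_nonpos) auto
  finally have "t * t * t + t * t * (y + y) \<le> 0" .
  moreover have "0 \<le> t * t * (y + y)" "0 \<le> t * t * t"
    using t y by simp_all
  ultimately have "t * t * t = 0" by (metis add_nonneg_eq_0_iff add_nonneg_nonneg antisym)
  then have "(t * t) * (t * t) = 0" by (metis mult.assoc mult_zero_left)
  then have "t = 0" by (metis square_eq_0_imp_eq_0)
  then show ?thesis unfolding t_def le_zero_iff_zero_pprt[symmetric] by simp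
qed

lemma archimedean_limit:
  fixes x y :: "'a::archimedean_vector_lattice"
  assumes "\<And>n::nat. x \<le> (1 / 2 ^ n) *\<^sub>R y" and "0 \<le> y"
  shows "x \<le> 0"
proof (rule archimedean_property)
  fix n :: nat
  have "real n *\<^sub>R x \<le> real n *\<^sub>R ((1 / 2 ^ n) *\<^sub>R y)"
    by (intro scaleR_left_mono assms) simp
  also have "\<dots> = (real n / 2 ^ n) *\<^sub>R y" by simp
  also have "\<dots> \<le> 1 *\<^sub>R y"
    using assms(2) of_nat_less_two_power[of n, where 'a = real] by (intro scaleR_right_mono) auto
  finally show "real n *\<^sub>R x \<le> y" by simp
qed

text \<open>
  Write \<open>r = a\<^sup>2 + b\<^sup>2\<close>. Squaring the rotations of \<open>(a, b)\<close> shows that the real and imaginary parts of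
  \<open>(a + i b)\<^sup>2\<close> have all their rotations below \<open>q = 2 p\<^sup>2 - r\<close>, and the sum of their squares is \<open>r\<^sup>2\<close>.
  If the claim is known with the factor \<open>(1 + \<delta>)\<^sup>2\<close> for every pair, it therefore yields
  \<open>r \<le> (1 + \<delta>) (2 p\<^sup>2 - r)\<close>. Solving for \<open>r\<close> gives the factor \<open>2 (1 + \<delta>) / (2 + \<delta>) \<le> 1 + \<delta> / 2\<close>, so
  each doubling of the angle halves \<open>\<delta>\<close>.
\<close>

lemma square_le_if_rotations_le_approx:
  fixes a b p :: "'a::{archimedean_vector_lattice, phi_algebra}"
  assumes "\<And>\<theta>. cos \<theta> *\<^sub>R a + sin \<theta> *\<^sub>R b \<le> p"
  shows "a * a + b * b \<le> (1 + 1 / 2 ^ k)\<^sup>2 *\<^sub>R (p * p)"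
  using assms
proof (induction k arbitrary: a b p)
  case 0
  have rot: "cos \<theta> *\<^sub>R a + sin \<theta> *\<^sub>R b \<le> p" for \<theta> by (rule 0)
  have "y * y \<le> p * p" if "y \<le> p" "- y \<le> p" for y
  proof -
    have "0 \<le> p + y" using add_left_mono[OF that(2), of y] by (simp add: add.commute)
    then have "0 \<le> (p - y) * (p + y)" using that(1) by (intro mult_nonneg_nonneg) simp_all
    also have "\<dots> = p * p - y * y" by (simp add: algebra_simps phi_algebra_commute[of p y])
    finally show ?thesis by simp
  qed
  then have "a * a + b * b \<le> p * p + p * p"
    using rot[of 0] rot[of pi] rot[of "pi / 2"] rot[of "3 / 2 * pi"]
    unfolding cos_3over2_pi sin_3over2_pi by (intro add_mono) simp_all
  also have "\<dots> = 2 *\<^sub>R (p * p)" by (simp add: scaleR_2)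
  also have "\<dots> \<le> 4 *\<^sub>R (p * p)" by (intro scaleR_right_mono square_nonneg) simp
  finally show ?case by (simp add: power2_eq_square)
next
  case (Suc k)
  define \<delta> :: real where "\<delta> = 1 / 2 ^ k"
  have \<delta>: "0 < \<delta>" by (simp add: \<delta>_def)
  define r where "r = a * a + b * b"
  define q where "q = 2 *\<^sub>R (p * p) - r"
  have rot: "cos \<theta> *\<^sub>R a + sin \<theta> *\<^sub>R b \<le> p" for \<theta> by (rule Suc.prems)
  have rot2: "cos \<theta> *\<^sub>R (a * a - b * b) + sin \<theta> *\<^sub>R (2 *\<^sub>R (a * b)) \<le> q" for \<theta>
  proof -
    define c s where "c = cos (\<theta> / 2)" and "s = sin (\<theta> / 2)"
    define x where "x = c *\<^sub>R a + s *\<^sub>R b"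
    have cs: "cos \<theta> = 2 * (c * c) - 1" "cos \<theta> = 1 - 2 * (s * s)" "sin \<theta> = 2 * (s * c)"
      using cos_double_cos[of "\<theta> / 2"] cos_double_sin[of "\<theta> / 2"] sin_double[of "\<theta> / 2"]
      by (simp_all add: c_def s_def power2_eq_square)
    have "- x \<le> p"
      using rot[of "\<theta> / 2 + pi"] by (simp add: x_def c_def s_def)
    then have "0 \<le> p + x" using add_left_mono[of "- x" p x] by (simp add: add.commute)
    moreover have "x \<le> p" unfolding x_def c_def s_def by (rule rot)
    ultimately have "0 \<le> (p - x) * (p + x)" by (intro mult_nonneg_nonneg) simp_all
    also have "\<dots> = p * p - x * x" by (simp add: algebra_simps phi_algebra_commute[of p x])
    finally have "2 *\<^sub>R (x * x) - r \<le> q" unfolding q_def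
      by (intro diff_right_mono scaleR_left_mono) simp_all
    also have "2 *\<^sub>R (x * x) - r = (2 * (c * c) - 1) *\<^sub>R (a * a) - (1 - 2 * (s * s)) *\<^sub>R (b * b)
        + (2 * (s * c)) *\<^sub>R (2 *\<^sub>R (a * b))"
    proof -
      have "x * x = (c * c) *\<^sub>R (a * a) + (s * s) *\<^sub>R (b * b) + (s * c) *\<^sub>R (2 *\<^sub>R (a * b))"
        by (simp add: x_def scaleR_2 distrib_left distrib_right scaleR_add_right
            phi_algebra_commute[of b a] mult.commute[of s c])
      then show ?thesis
        by (simp add: r_def scaleR_add_right scaleR_diff_left)
    qed
    finally show ?thesis unfolding scaleR_diff_right using cs by metis
  qed
  have q: "0 \<le> q"
    using add_mono[OF rot2[of 0] rot2[of pi]] by simp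
  have "r * r = (a * a - b * b) * (a * a - b * b) + (2 *\<^sub>R (a * b)) * (2 *\<^sub>R (a * b))"
    by (simp add: r_def scaleR_2 distrib_left distrib_right left_diff_distrib right_diff_distrib
        phi_algebra_ac)
  also have "\<dots> \<le> (1 + \<delta>)\<^sup>2 *\<^sub>R (q * q)"
    unfolding \<delta>_def by (rule Suc.IH) (rule rot2)
  also have "\<dots> = ((1 + \<delta>) *\<^sub>R q) * ((1 + \<delta>) *\<^sub>R q)" by (simp add: power2_eq_square)
  finally have "r \<le> (1 + \<delta>) *\<^sub>R q"
    by (rule square_le_imp_le[rotated]) (use q \<delta> in \<open>simp add: scaleR_nonneg_nonneg\<close>)
  then have "r + (1 + \<delta>) *\<^sub>R r \<le> (1 + \<delta>) *\<^sub>R 2 *\<^sub>R (p * p)"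
    by (simp only: q_def scaleR_diff_right le_diff_eq)
  then have "inverse (2 + \<delta>) *\<^sub>R ((2 + \<delta>) *\<^sub>R r) \<le> inverse (2 + \<delta>) *\<^sub>R ((1 + \<delta>) *\<^sub>R 2 *\<^sub>R (p * p))"
    using \<delta> by (intro scaleR_left_mono) (simp_all add: scaleR_add_left scaleR_2 add.assoc)
  then have "r \<le> (inverse (2 + \<delta>) * ((1 + \<delta>) * 2)) *\<^sub>R (p * p)"
    using \<delta> by simp
  also have "\<dots> \<le> (1 + 1 / 2 ^ Suc k)\<^sup>2 *\<^sub>R (p * p)"
  proof (rule scaleR_right_mono)
    have "inverse (2 + \<delta>) * ((1 + \<delta>) * 2) \<le> (1 + \<delta> / 2)\<^sup>2"
      using \<delta> by (simp add: field_simps power2_eq_square)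
    then show "inverse (2 + \<delta>) * ((1 + \<delta>) * 2) \<le> (1 + 1 / 2 ^ Suc k)\<^sup>2"
      by (simp add: \<delta>_def mult.commute)
  qed (rule square_nonneg)
  finally show ?case by (simp add: r_def)
qed

lemma square_le_if_rotations_le:
  fixes a b p :: "'a::{archimedean_vector_lattice, phi_algebra}"
  assumes "\<And>\<theta>. cos \<theta> *\<^sub>R a + sin \<theta> *\<^sub>R b \<le> p"
  shows "a * a + b * b \<le> p * p"
proof -
  have "a * a + b * b - p * p \<le> (1 / 2 ^ k) *\<^sub>R (3 *\<^sub>R (p * p))" for k
  proof -
    define \<delta> :: real where "\<delta> = 1 / 2 ^ k"
    have \<delta>: "0 \<le> \<delta>" "\<delta> \<le> 1" by (simp_all add: \<delta>_def)
    have "a * a + b * b \<le> (1 + \<delta>)\<^sup>2 *\<^sub>R (p * p)"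
      unfolding \<delta>_def by (rule square_le_if_rotations_le_approx) (rule assms)
    also have "\<dots> \<le> (1 + \<delta> * 3) *\<^sub>R (p * p)"
    proof (intro scaleR_right_mono square_nonneg)
      have "\<delta> * \<delta> \<le> \<delta> * 1" using \<delta> by (intro mult_left_mono) auto
      then show "(1 + \<delta>)\<^sup>2 \<le> 1 + \<delta> * 3" by (simp add: power2_eq_square algebra_simps)
    qed
    also have "\<dots> = \<delta> *\<^sub>R (3 *\<^sub>R (p * p)) + p * p" by (simp add: scaleR_add_left)
    finally show ?thesis by (simp only: diff_le_eq \<delta>_def)
  qed
  then have "a * a + b * b - p * p \<le> 0"
    by (rule archimedean_limit) (intro scaleR_nonneg_nonneg square_nonneg; simp)
  then show ?thesis by simp
qed

section \<open>The modulus of the complexification\<close>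

text \<open>
  The angle is arbitrary here, whereas the supremum defining the modulus runs over one period.
\<close>

lemma rotation_le_modulus: "cos \<theta> *\<^sub>R re_part z + sin \<theta> *\<^sub>R im_part z \<le> modulus z"
proof -
  obtain \<phi> where "\<phi> \<in> {0..2 * pi}" "cos \<theta> = cos \<phi>" "sin \<theta> = sin \<phi>"
    using sincos_total_2pi_le[of "cos \<theta>" "sin \<theta>"] by auto
  then show ?thesis
    unfolding modulus_def square_mean_def
    by (auto intro: cSUP_upper bdd_above_square_mean)
qed

lemma modulus_le:
  assumes "\<And>\<theta>. cos \<theta> *\<^sub>R re_part z + sin \<theta> *\<^sub>R im_part z \<le> p"
  shows "modulus z \<le> p"
  unfolding modulus_def square_mean_def by (rule cSUP_least) (use assms in auto)

lemma modulus_nonneg: "0 \<le> modulus z"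
  using abs_re_part_le_modulus[of z] abs_ge_zero order_trans by blast

lemma modulus_add_le: "modulus (z + w) \<le> modulus z + modulus w"
proof (rule modulus_le)
  fix \<theta>
  show "cos \<theta> *\<^sub>R re_part (z + w) + sin \<theta> *\<^sub>R im_part (z + w) \<le> modulus z + modulus w"
    using add_mono[OF rotation_le_modulus[of \<theta> z] rotation_le_modulus[of \<theta> w]]
    by (simp add: plus_complexification_def scaleR_add_right add_ac)
qed

lemma modulus_minus: "modulus (- z) = modulus z"
proof -
  have le: "modulus (- z) \<le> modulus z" for z :: "'a complexification"
  proof (rule modulus_le)
    fix \<theta>
    show "cos \<theta> *\<^sub>R re_part (- z) + sin \<theta> *\<^sub>R im_part (- z) \<le> modulus z"
      using rotation_le_modulus[of "\<theta> + pi" z] by (simp add: uminus_complexification_def)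
  qed
  show ?thesis using le[of z] le[of "- z"] by (intro antisym) auto
qed

lemma modulus_diff_commute: "modulus (z - w) = modulus (w - z)"
  using modulus_minus[of "z - w"] by simp

lemma modulus_le_abs_add: "modulus z \<le> \<bar>re_part z\<bar> + \<bar>im_part z\<bar>"
  by (rule modulus_le) (intro add_mono scaleR_le_abs; simp)

lemma modulus_zero: "modulus 0 = 0"
  by (rule antisym[OF _ modulus_nonneg], rule order_trans[OF modulus_le_abs_add])
    (simp add: zero_complexification_def)

lemma modulus_sum_le: "modulus (\<Sum>i\<in>A. f i) \<le> (\<Sum>i\<in>A. modulus (f i))"
proof (induction A rule: infinite_finite_induct)
  case (insert x F)
  then show ?case by simp (meson add_left_mono modulus_add_le order_trans)
qed (simp_all add: modulus_zero)

text \<open>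
  A rotation of \<open>z w\<close> is the real part of \<open>z' w\<close> for a rotated \<open>z'\<close>, which has the same modulus
  bound. For the real part \<open>a' c - b' d\<close> the identity of Brahmagupta gives
  \<open>(a' c - b' d)\<^sup>2 \<le> (a'\<^sup>2 + b'\<^sup>2) (c\<^sup>2 + d\<^sup>2) \<le> |z|\<^sup>2 |w|\<^sup>2\<close>.
\<close>

lemma modulus_mult_le:
  fixes z w :: "'a::universally_complete_phi_algebra complexification"
  shows "modulus (z * w) \<le> modulus z * modulus w"
proof (rule modulus_le)
  fix \<theta>
  define a b c d where "a = re_part z" and "b = im_part z" and "c = re_part w" and "d = im_part w"
  define a' b' where "a' = cos \<theta> *\<^sub>R a + sin \<theta> *\<^sub>R b" and "b' = cos \<theta> *\<^sub>R b - sin \<theta> *\<^sub>R a"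
  have rotated: "cos \<theta> *\<^sub>R re_part (z * w) + sin \<theta> *\<^sub>R im_part (z * w) = a' * c - b' * d"
    by (simp add: times_complexification_def a'_def b'_def a_def b_def c_def d_def
        scaleR_add_right scaleR_diff_right distrib_right left_diff_distrib)
  have "a' * a' + b' * b' \<le> modulus z * modulus z"
  proof (rule square_le_if_rotations_le)
    fix \<phi>
    have "cos \<phi> *\<^sub>R a' + sin \<phi> *\<^sub>R b' = cos (\<theta> + \<phi>) *\<^sub>R a + sin (\<theta> + \<phi>) *\<^sub>R b"
      by (simp add: a'_def b'_def cos_add sin_add scaleR_add_right scaleR_diff_right
          scaleR_add_left scaleR_diff_left mult.commute)
    then show "cos \<phi> *\<^sub>R a' + sin \<phi> *\<^sub>R b' \<le> modulus z"
      using rotation_le_modulus[of "\<theta> + \<phi>" z] by (simp add: a_def b_def)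
  qed
  moreover have "c * c + d * d \<le> modulus w * modulus w"
    unfolding c_def d_def by (intro square_le_if_rotations_le rotation_le_modulus)
  ultimately have "(a' * a' + b' * b') * (c * c + d * d) \<le>
      (modulus z * modulus z) * (modulus w * modulus w)"
    by (intro mult_mono add_nonneg_nonneg square_nonneg)
  moreover have "(a' * c - b' * d) * (a' * c - b' * d) =
      (a' * a' + b' * b') * (c * c + d * d) - (a' * d + b' * c) * (a' * d + b' * c)"
    by (simp add: distrib_left distrib_right left_diff_distrib right_diff_distrib phi_algebra_ac)
  moreover have "(modulus z * modulus z) * (modulus w * modulus w) =
      (modulus z * modulus w) * (modulus z * modulus w)"
    by (simp only: phi_algebra_ac)
  moreover have "u = r - t \<Longrightarrow> 0 \<le> t \<Longrightarrow> r \<le> v \<Longrightarrow> v = v' \<Longrightarrow> u \<le> v'" for u r t v v' :: 'a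
    by (metis diff_left_mono diff_0_right order_trans)
  ultimately have "(a' * c - b' * d) * (a' * c - b' * d) \<le>
      (modulus z * modulus w) * (modulus z * modulus w)"
    using square_nonneg[of "a' * d + b' * c"] by blast
  then have "a' * c - b' * d \<le> modulus z * modulus w"
    by (rule square_le_imp_le[rotated]) (simp add: modulus_nonneg)
  then show "cos \<theta> *\<^sub>R re_part (z * w) + sin \<theta> *\<^sub>R im_part (z * w) \<le> modulus z * modulus w"
    by (simp only: rotated)
qed

lemma modulus_one_le: "modulus (1 :: 'a::universally_complete_phi_algebra complexification) \<le> 1"
proof (rule modulus_le)
  fix \<theta> :: real
  have "cos \<theta> *\<^sub>R (1::'a) \<le> \<bar>1\<bar>" by (rule scaleR_le_abs) simp
  then show "cos \<theta> *\<^sub>R re_part (1 :: 'a complexification) + sin \<theta> *\<^sub>R im_part 1 \<le> 1"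
    by (simp add: one_complexification_def abs_of_nonneg one_nonneg)
qed

lemma modulus_power_le:
  fixes z :: "'a::universally_complete_phi_algebra complexification"
  shows "modulus (z ^ n) \<le> modulus z ^ n"
proof (induction n)
  case 0
  then show ?case by (simp add: modulus_one_le)
next
  case (Suc n)
  have "modulus (z ^ Suc n) \<le> modulus z * modulus (z ^ n)" by (simp add: modulus_mult_le)
  also have "\<dots> \<le> modulus z ^ Suc n" using Suc by (simp add: mult_left_mono modulus_nonneg)
  finally show ?case .
qed

section \<open>Inverses of weak order units\<close>

lemma disjoint_Sup:
  fixes t :: "'a::{vector_lattice, conditionally_complete_lattice}"
  assumes A: "A \<noteq> {}" "bdd_above A" and disj: "\<And>x. x \<in> A \<Longrightarrow> inf t x = 0"
  shows "inf t (Sup A) = 0"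
proof -
  obtain x0 where "x0 \<in> A" using A by blast
  then have nonneg: "0 \<le> t" "0 \<le> x0" using disj by (metis inf.cobounded1 inf.cobounded2)+
  then have "0 \<le> Sup A" using cSup_upper[OF \<open>x0 \<in> A\<close> A(2)] by simp
  define v where "v = inf t (Sup A)"
  have v: "0 \<le> v" "v \<le> t" "v \<le> Sup A" using nonneg \<open>0 \<le> Sup A\<close> by (simp_all add: v_def)
  have "x \<le> Sup A - v" if "x \<in> A" for x
  proof -
    have "inf x v = 0"
      using disjoint_mono[OF _ v(1,2), of x] disj[OF that] by (simp add: inf_commute)
    then have "x + v = sup x v" using add_eq_inf_sup[of x v] by simp
    also have "\<dots> \<le> Sup A" using that A v by (simp add: cSup_upper)
    finally show ?thesis by (simp add: le_diff_eq)
  qed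
  then have "Sup A \<le> Sup A - v" by (intro cSup_least A)
  then have "v \<le> 0" by simp
  with v(1) show ?thesis unfolding v_def by (rule antisym[rotated])
qed

text \<open>
  For \<open>g \<ge> 0\<close> this is the component of the unit in the band generated by \<open>g\<close>: in a function
  space, the indicator function of the support of \<open>g\<close>.
\<close>

definition component :: "'a::universally_complete_phi_algebra \<Rightarrow> 'a" where
  "component g = (SUP k::nat. inf (real k *\<^sub>R g) 1)"

lemma bdd_above_component:
  fixes g :: "'a::universally_complete_phi_algebra"
  shows "bdd_above (range (\<lambda>k::nat. inf (real k *\<^sub>R g) 1))"
  by (rule bdd_aboveI2[where M = 1]) simp

lemma component_upper: "inf (real k *\<^sub>R g) 1 \<le> component g"
  unfolding component_def by (rule cSUP_upper[OF _ bdd_above_component]) simp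

lemma component_le_one: "component g \<le> 1"
  unfolding component_def by (rule cSUP_least) auto

lemma component_nonneg: "0 \<le> component g"
  using component_upper[of 0 g] by (simp add: inf_absorb1 one_nonneg)

lemma component_mono:
  assumes "g \<le> h"
  shows "component g \<le> component h"
proof -
  have "inf (real k *\<^sub>R g) 1 \<le> component h" for k
    using assms by (intro order_trans[OF _ component_upper[of k]] inf_mono scaleR_left_mono) auto
  then show ?thesis unfolding component_def[of g] by (intro cSUP_least) auto
qed

lemma component_zero: "component 0 = 0"
  by (simp add: component_def inf_absorb1 one_nonneg)

lemma disjoint_component:
  assumes "inf t g = 0"
  shows "inf t (component g) = 0"
  unfolding component_def
proof (rule disjoint_Sup[OF _ bdd_above_component])
  have "0 \<le> g" using assms by (metis inf.cobounded2)
  fix x assume "x \<in> range (\<lambda>k::nat. inf (real k *\<^sub>R g) 1)"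
  then obtain k :: nat where x: "x = inf (real k *\<^sub>R g) 1" by blast
  show "inf t x = 0"
    by (rule disjoint_mono[OF disjoint_scaleR_of_nat[OF assms, of k]])
      (use \<open>0 \<le> g\<close> one_nonneg in \<open>simp_all add: x scaleR_nonneg_nonneg\<close>)
qed simp

text \<open>
  It suffices that the complement is disjoint from \<open>g\<close>. If \<open>s\<close> lies below both, then adding one more
  copy of \<open>s\<close> to \<open>n s \<le> inf (n g) 1 \<le> component g\<close> does not exceed the unit, so all multiples of \<open>s\<close>
  stay below it.
\<close>

lemma disjoint_component_complement:
  assumes g: "0 \<le> g"
  shows "inf (1 - component g) (component g) = 0"
proof (rule disjoint_component)
  define s where "s = inf (1 - component g) g"
  have s: "0 \<le> s" "s \<le> g" "s \<le> 1 - component g"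
    using g component_le_one[of g] by (simp_all add: s_def)
  have "real n *\<^sub>R s \<le> 1" for n
  proof (induction n)
    case 0
    then show ?case by (simp add: one_nonneg)
  next
    case (Suc n)
    have "real n *\<^sub>R s \<le> inf (real n *\<^sub>R g) 1"
      using Suc s by (simp add: scaleR_left_mono)
    also have "\<dots> \<le> component g" by (rule component_upper)
    finally have "real n *\<^sub>R s + s \<le> component g + (1 - component g)"
      using s by (intro add_mono)
    then show ?case by (simp add: scaleR_add_left add.commute)
  qed
  then have "s \<le> 0" by (rule archimedean_property)
  with s(1) show "inf (1 - component g) g = 0" unfolding s_def by (rule antisym[rotated])
qed

text \<open>
  The components of the unit on which \<open>n u > 1\<close> exhaust the unit as \<open>n\<close> grows, since an element
  disjoint from all of them is disjoint from the weak order unit \<open>u\<close>.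
\<close>

lemma le_complement_components_imp_eq_0:
  assumes u: "weak_order_unit u" and y: "0 \<le> y"
    and le: "\<And>n::nat. y \<le> 1 - component (pprt (real n *\<^sub>R u - 1))"
  shows "y = 0"
proof -
  have "inf y (pprt (real n *\<^sub>R u - 1)) = 0" for n :: nat
  proof -
    define g where "g = pprt (real n *\<^sub>R u - 1)"
    have g: "0 \<le> g" by (simp add: g_def)
    have "y \<le> 1" using le[of n] component_nonneg order_trans by (metis diff_le_eq le_add_same_cancel1)
    have "inf (component g) y = 0"
      using disjoint_mono[OF _ y, of "component g" "1 - component g"] le[of n]
        disjoint_component_complement[OF g] by (simp add: g_def inf_commute)
    then have "inf y (inf g 1) = 0"
      using disjoint_mono[of y "component g" "inf g 1"] component_upper[of 1 g] g one_nonneg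
      by (simp add: inf_commute)
    then have "inf (inf y 1) g = 0" by (simp only: inf_aci)
    then show ?thesis using \<open>y \<le> 1\<close> by (simp add: g_def inf_absorb1)
  qed
  moreover have "0 \<le> u" using u by (simp add: weak_order_unit_def)
  ultimately have "inf y u = 0"
    using disjoint_if_disjoint_pprt_multiples[OF y _ one_nonneg] by blast
  then have "inf u \<bar>y\<bar> = 0" using y by (simp add: abs_of_nonneg inf_commute)
  then show ?thesis using u unfolding weak_order_unit_def by blast
qed

lemma power_nonneg_le_one:
  fixes x :: "'a::phi_algebra"
  assumes "0 \<le> x" "x \<le> 1"
  shows "0 \<le> x ^ n \<and> x ^ n \<le> 1"
proof (induction n)
  case (Suc n)
  then have "x * x ^ n \<le> 1 * 1" using assms one_nonneg by (intro mult_mono) auto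
  then show ?case using Suc assms by simp
qed (simp add: one_nonneg)

lemma one_minus_mult_geometric_sum:
  fixes x :: "'a::{ring, monoid_mult}"
  shows "(1 - x) * (\<Sum>i<m. x ^ i) = 1 - x ^ m"
  by (induction m) (simp_all add: distrib_left left_diff_distrib)

text \<open>
  Let \<open>u = 1 - x\<close> and let \<open>e\<^sub>n\<close> be the component of the unit on which \<open>n u > 1\<close>. On the disjoint
  pieces \<open>d\<^sub>n = e\<^sub>n\<^sub>+\<^sub>1 - e\<^sub>n\<close> the element \<open>(n + 1) u\<close> is at least one, so a geometric sum \<open>w\<close>, which
  satisfies \<open>u w \<le> 1\<close>, is at most \<open>n + 1\<close> there. Lateral completeness provides an upper bound \<open>b\<close> for
  all \<open>(n + 1) d\<^sub>n\<close>. Then \<open>w e\<^sub>n \<le> b\<close> for every \<open>n\<close>, and \<open>w \<le> b\<close> because the components \<open>e\<^sub>n\<close> exhaust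
  the unit.
\<close>

lemma geometric_sum_bounded:
  fixes x :: "'a::universally_complete_phi_algebra"
  assumes x: "0 \<le> x" "x \<le> 1" and unit: "weak_order_unit (1 - x)"
  shows "\<exists>b. \<forall>m. (\<Sum>i<m. x ^ i) \<le> b"
proof -
  define u where "u = 1 - x"
  define g where "g n = pprt (real n *\<^sub>R u - 1)" for n :: nat
  define e where "e n = component (g n)" for n
  define d where "d n = e (Suc n) - e n" for n
  have u: "0 \<le> u" using x by (simp add: u_def)
  have g: "0 \<le> g n" for n by (simp add: g_def)
  have "g n \<le> g (Suc n)" for n
    using u unfolding g_def by (intro pprt_mono diff_right_mono scaleR_right_mono) auto
  then have e_Suc: "e n \<le> e (Suc n)" for n unfolding e_def by (intro component_mono)
  then have e_mono: "e m \<le> e n" if "m \<le> n" for m n using lift_Suc_mono_le[of e, OF _ that] by blast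
  have d_nonneg: "0 \<le> d n" for n using e_Suc by (simp add: d_def)
  have d_le: "d n \<le> e (Suc n)" "d n \<le> 1 - e n" for n
    using component_nonneg[of "g n"] component_le_one[of "g (Suc n)"]
    by (simp_all add: d_def e_def diff_right_mono)
  have e_d: "inf (e m) (d n) = 0" if "m \<le> n" for m n
  proof -
    have "inf (1 - e n) (e n) = 0" unfolding e_def by (intro disjoint_component_complement g)
    then have "inf (1 - e n) (e m) = 0"
      by (rule disjoint_mono) (use that e_mono component_nonneg in \<open>auto simp: e_def\<close>)
    then have "inf (e m) (1 - e n) = 0" by (simp add: inf_commute)
    then show ?thesis by (rule disjoint_mono) (use d_nonneg d_le in auto)
  qed
  have d_disj: "inf (d m) (d n) = 0" if "m < n" for m n
  proof -
    have "inf (d n) (e (Suc m)) = 0" using e_d[of "Suc m" n] that by (simp add: inf_commute)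
    then have "inf (d n) (d m) = 0" by (rule disjoint_mono) (use d_nonneg d_le in auto)
    then show ?thesis by (simp add: inf_commute)
  qed
  have scaled_disj: "inf (real (Suc m) *\<^sub>R d m) (real (Suc n) *\<^sub>R d n) = 0" if "m \<noteq> n" for m n
  proof -
    have "inf (d m) (d n) = 0" using d_disj that by (metis inf_commute linorder_neqE_nat)
    then show ?thesis by (metis disjoint_scaleR_of_nat inf_commute)
  qed
  obtain b where b: "\<And>n. real (Suc n) *\<^sub>R d n \<le> b"
  proof -
    let ?A = "range (\<lambda>n. real (Suc n) *\<^sub>R d n)"
    have "\<exists>s. (\<forall>x\<in>?A. x \<le> s) \<and> (\<forall>v. (\<forall>x\<in>?A. x \<le> v) \<longrightarrow> s \<le> v)"
    proof (rule laterally_complete)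
      fix y z assume "y \<in> ?A" "z \<in> ?A" "y \<noteq> z"
      then obtain m n where "y = real (Suc m) *\<^sub>R d m" "z = real (Suc n) *\<^sub>R d n" by blast
      moreover from this \<open>y \<noteq> z\<close> have "m \<noteq> n" by auto
      ultimately show "inf y z = 0" using scaled_disj by simp
    qed (auto intro!: scaleR_nonneg_nonneg d_nonneg simp del: of_nat_Suc)
    then show ?thesis using that by blast
  qed
  have "(\<Sum>i<m. x ^ i) \<le> b" for m
  proof -
    define w where "w = (\<Sum>i<m. x ^ i)"
    have pow: "0 \<le> x ^ i" "x ^ i \<le> 1" for i using power_nonneg_le_one[OF x] by auto
    have w: "0 \<le> w" unfolding w_def by (intro sum_nonneg pow)
    have uw: "u * w \<le> 1"
      using pow by (simp add: u_def w_def one_minus_mult_geometric_sum)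
    have w_le: "w \<le> real m *\<^sub>R 1"
      using sum_mono[of "{..<m}" "\<lambda>i. x ^ i" "\<lambda>_. 1"] pow
      unfolding w_def by (simp add: sum_constant_scaleR)
    have w_d: "w * d n \<le> b" for n
    proof -
      define r where "r = real (Suc n) *\<^sub>R u - 1"
      have "inf (pprt (- r)) (e (Suc n)) = 0"
        unfolding e_def g_def r_def
        by (intro disjoint_component) (metis disjoint_pprt_pprt_minus inf_commute)
      then have "inf (pprt (- r)) (d n) = 0"
        by (rule disjoint_mono) (use d_nonneg d_le in auto)
      then have "pprt (- r) * d n = 0" by (rule disjoint_imp_mult_eq_0)
      then have "(pprt r - pprt (- r)) * d n = pprt r * d n" by (simp add: left_diff_distrib)
      then have "r * d n = pprt r * d n" by (simp only: pprt_minus_pprt_minus)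
      then have "0 \<le> r * d n" using d_nonneg by simp
      then have "d n \<le> real (Suc n) *\<^sub>R (u * d n)"
        by (simp only: r_def left_diff_distrib mult_scaleR_left mult_1_left diff_ge_0_iff_ge)
      then have "w * d n \<le> w * (real (Suc n) *\<^sub>R (u * d n))" using w by (rule mult_left_mono)
      also have "\<dots> = real (Suc n) *\<^sub>R (u * w * d n)" by (simp add: phi_algebra_ac)
      also have "\<dots> \<le> real (Suc n) *\<^sub>R (1 * d n)"
        using uw d_nonneg by (intro scaleR_left_mono mult_right_mono) auto
      also have "\<dots> \<le> b" using b by simp
      finally show ?thesis .
    qed
    have w_e: "w * e n \<le> b" for n
    proof (induction n)
      case 0
      have "e 0 = 0" by (simp add: e_def g_def component_zero one_nonneg)
      moreover have "0 \<le> b" using b[of 0] d_nonneg[of 0] by simp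
      ultimately show ?case by simp
    next
      case (Suc n)
      have "inf (w * e n) (w * d n) = 0"
        using e_d[of n n] w by (metis disjoint_mult_left inf_commute order_refl)
      then have "w * e n + w * d n = sup (w * e n) (w * d n)"
        using add_eq_inf_sup[of "w * e n" "w * d n"] by simp
      also have "\<dots> \<le> b" using Suc w_d by simp
      finally show ?case by (simp add: d_def right_diff_distrib)
    qed
    \<comment> \<open>Since \<open>w \<le> m\<close>, the bound \<open>w - b \<le> w (1 - e n)\<close> puts \<open>t\<close> below every \<open>1 - e n\<close>.\<close>
    define t where "t = inverse (real (Suc m)) *\<^sub>R pprt (w - b)"
    have "t \<le> 1 - e n" for n
    proof -
      have e: "0 \<le> 1 - e n" by (simp add: e_def component_le_one)
      have "w - b \<le> w - w * e n" using w_e by (rule diff_left_mono)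
      also have "\<dots> = w * (1 - e n)" by (simp add: right_diff_distrib)
      also have "\<dots> \<le> (real m *\<^sub>R 1) * (1 - e n)" using w_le e by (rule mult_right_mono)
      also have "\<dots> = real m *\<^sub>R (1 - e n)" by (simp add: mult_scaleR_left)
      also have "\<dots> \<le> real (Suc m) *\<^sub>R (1 - e n)" using e by (intro scaleR_right_mono) auto
      finally have "pprt (w - b) \<le> real (Suc m) *\<^sub>R (1 - e n)"
        using e by (simp add: pprt_def scaleR_nonneg_nonneg del: of_nat_Suc)
      then have "t \<le> inverse (real (Suc m)) *\<^sub>R (real (Suc m) *\<^sub>R (1 - e n))"
        unfolding t_def by (intro scaleR_left_mono) auto
      then show ?thesis by simp
    qed
    moreover have "0 \<le> t" by (simp add: t_def scaleR_nonneg_nonneg)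
    ultimately have "t = 0"
      using le_complement_components_imp_eq_0[of u t] unit by (simp add: e_def g_def u_def)
    then have "pprt (w - b) = 0" by (simp add: t_def)
    then have "w - b \<le> 0" by (simp only: le_zero_iff_zero_pprt)
    then show ?thesis by (simp add: w_def)
  qed
  then show ?thesis by blast
qed

text \<open>
  The inverse \<open>v\<close> is the supremum of the geometric sums \<open>w m\<close>. From \<open>w m \<le> 1 + x v\<close> one gets
  \<open>(1 - x) v \<le> 1\<close>. Conversely \<open>1 - (1 - x) v\<close> is at most every power of \<open>x\<close>, so its multiples are
  bounded by geometric sums and hence by \<open>v\<close>, and it is at most \<open>0\<close> by the Archimedean property.
\<close>

lemma one_minus_invertible:
  fixes x :: "'a::universally_complete_phi_algebra"
  assumes x: "0 \<le> x" "x \<le> 1" and unit: "weak_order_unit (1 - x)"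
  shows "\<exists>v. (1 - x) * v = 1 \<and> v * (1 - x) = 1 \<and> (\<forall>m. (\<Sum>i<m. x ^ i) \<le> v)"
proof -
  define w where "w m = (\<Sum>i<m. x ^ i)" for m
  obtain b where b: "\<And>m. w m \<le> b" using geometric_sum_bounded[OF assms] unfolding w_def by blast
  define v where "v = (SUP m. w m)"
  have bdd: "bdd_above (range w)" using b by (rule bdd_aboveI2)
  have w_le: "w m \<le> v" for m unfolding v_def by (intro cSUP_upper bdd) simp
  have pow: "0 \<le> x ^ i" "x ^ i \<le> 1" for i using power_nonneg_le_one[OF x] by auto
  have "w m \<le> 1 + x * v" for m
  proof -
    have "w m \<le> w (Suc m)" using pow by (simp add: w_def)
    also have "w (Suc m) = 1 + x * w m"
      by (simp add: w_def sum.lessThan_Suc_shift sum_distrib_left del: sum.lessThan_Suc)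
    also have "\<dots> \<le> 1 + x * v" using x w_le by (intro add_left_mono mult_left_mono)
    finally show ?thesis .
  qed
  then have "v \<le> 1 + x * v" unfolding v_def by (intro cSUP_least) auto
  then have le: "(1 - x) * v \<le> 1" by (simp add: left_diff_distrib diff_le_eq add.commute)
  have "real m *\<^sub>R (1 - (1 - x) * v) \<le> v" for m
  proof -
    have "(1 - x) * w m \<le> (1 - x) * v" using x w_le by (intro mult_left_mono) auto
    then have "1 - (1 - x) * v \<le> x ^ m"
      by (simp add: w_def one_minus_mult_geometric_sum diff_le_eq le_diff_eq add.commute)
    moreover have "x ^ m \<le> x ^ i" if "i \<le> m" for i
      using that pow x mult_right_mono[of "x ^ (m - i)" 1 "x ^ i"]
      by (simp flip: power_add)
    ultimately have "(\<Sum>i<m. 1 - (1 - x) * v) \<le> w m"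
      unfolding w_def by (intro sum_mono) (meson lessThan_iff less_imp_le order_trans)
    then have "real m *\<^sub>R (1 - (1 - x) * v) \<le> w m" by (simp add: sum_constant_scaleR)
    then show ?thesis using w_le by (rule order_trans)
  qed
  then have "1 - (1 - x) * v \<le> 0" by (rule archimedean_property)
  with le have "(1 - x) * v = 1" by (intro antisym) auto
  then show ?thesis using w_le by (metis phi_algebra_commute w_def)
qed

text \<open>
  The negative part of \<open>1 - x\<close> is disjoint from the weak order unit \<open>(1 - x)\<^sup>+\<close>, so it vanishes.
\<close>

lemma much_less_one:
  assumes "x \<lless> 1"
  shows "x \<le> 1" "weak_order_unit (1 - x)"
proof -
  have "inf (pprt (1 - x)) \<bar>pprt (- (1 - x))\<bar> = 0"
    using disjoint_pprt_pprt_minus[of "1 - x"] by (simp add: abs_of_nonneg del: minus_diff_eq)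
  then have "pprt (- (1 - x)) = 0"
    using assms unfolding much_less_def weak_order_unit_def by blast
  then have "- (1 - x) \<le> 0" by (simp only: le_zero_iff_zero_pprt)
  then show "x \<le> 1" by simp
  then show "weak_order_unit (1 - x)" using assms by (simp add: much_less_def)
qed

section \<open>Order convergence\<close>

lemma decreases_to_zeroI:
  assumes "decseq p" and nonneg: "\<And>n. 0 \<le> p n" and zero: "\<And>y. (\<And>n. y \<le> p n) \<Longrightarrow> y \<le> 0"
  shows "decreases_to_zero p"
proof -
  have "bdd_below (range p)" using nonneg by (rule bdd_belowI2)
  then have "(INF n. p n) \<le> p n" for n by (rule cINF_lower) simp
  then have "(INF n. p n) \<le> 0" by (rule zero)
  moreover have "0 \<le> (INF n. p n)" using nonneg by (intro cINF_greatest) auto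
  ultimately show ?thesis using assms(1) nonneg by (simp add: decreases_to_zero_def antisym)
qed

lemma decreases_to_zero_le_imp:
  assumes "decreases_to_zero p" "\<And>n. y \<le> p n"
  shows "y \<le> 0"
proof -
  have "y \<le> (INF n. p n)" using assms(2) by (intro cINF_greatest) auto
  then show ?thesis using assms(1) by (simp add: decreases_to_zero_def)
qed

lemma decreases_to_zero_nonneg: "decreases_to_zero p \<Longrightarrow> 0 \<le> p n"
  by (simp add: decreases_to_zero_def)

lemma decreases_to_zero_mono: "decreases_to_zero p \<Longrightarrow> m \<le> n \<Longrightarrow> p n \<le> p m"
  by (simp add: decreases_to_zero_def decseqD)

lemma decreases_to_zero_add:
  assumes p: "decreases_to_zero p" and q: "decreases_to_zero q"
  shows "decreases_to_zero (\<lambda>n. p n + q n)"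
proof (rule decreases_to_zeroI)
  show "decseq (\<lambda>n. p n + q n)"
    using decreases_to_zero_mono[OF p] decreases_to_zero_mono[OF q]
    by (auto simp: decseq_def intro!: add_mono)
  show "0 \<le> p n + q n" for n using p q by (simp add: decreases_to_zero_nonneg)
  show "y \<le> 0" if "\<And>n. y \<le> p n + q n" for y using decreases_to_zero_add_le[OF p q that] .
qed

text \<open>
  An estimate of \<open>c\<close> by multiples of the unit is available only up to \<open>c\<^sup>2\<close>: from
  \<open>2 k c \<le> k\<^sup>2 + c\<^sup>2\<close> it follows that a lower bound \<open>y\<close> of all \<open>c p\<^sub>n\<close> satisfies \<open>k y \<le> k\<^sup>2 p\<^sub>n + c\<^sup>2 p\<^sub>0\<close>. Letting \<open>n\<close> grow leaves
  \<open>k y \<le> c\<^sup>2 p\<^sub>0\<close> for all \<open>k\<close>.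
\<close>

lemma decreases_to_zero_mult_left:
  fixes p :: "nat \<Rightarrow> 'a::universally_complete_phi_algebra"
  assumes p: "decreases_to_zero p" and c: "0 \<le> c"
  shows "decreases_to_zero (\<lambda>n. c * p n)"
proof (rule decreases_to_zeroI)
  show "decseq (\<lambda>n. c * p n)"
    using c decreases_to_zero_mono[OF p] by (auto simp: decseq_def intro!: mult_left_mono)
  show "0 \<le> c * p n" for n using c decreases_to_zero_nonneg[OF p] by simp
  fix y assume y: "\<And>n. y \<le> c * p n"
  have "real k *\<^sub>R y \<le> c * c * p 0" for k
  proof -
    have "real k *\<^sub>R y - c * c * p 0 \<le> (real k * real k) *\<^sub>R p n" for n
    proof -
      have pn: "0 \<le> p n" by (rule decreases_to_zero_nonneg[OF p])
      have "0 \<le> (real k *\<^sub>R 1 - c) * (real k *\<^sub>R 1 - c)" by (rule square_nonneg)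
      also have "\<dots> = ((real k * real k) *\<^sub>R 1 + c * c) - (real k *\<^sub>R c + real k *\<^sub>R c)"
        by (simp add: left_diff_distrib right_diff_distrib scaleR_diff_right algebra_simps)
      finally have "real k *\<^sub>R c + real k *\<^sub>R c \<le> (real k * real k) *\<^sub>R 1 + c * c" by simp
      moreover have "0 \<le> real k *\<^sub>R c" using c by (simp add: scaleR_nonneg_nonneg)
      ultimately have "real k *\<^sub>R c \<le> (real k * real k) *\<^sub>R 1 + c * c"
        by (meson le_add_same_cancel1 order_trans)
      then have "(real k *\<^sub>R c) * p n \<le> ((real k * real k) *\<^sub>R 1 + c * c) * p n"
        using pn by (rule mult_right_mono)
      also have "\<dots> = (real k * real k) *\<^sub>R p n + c * c * p n" by (simp add: distrib_right)
      also have "\<dots> \<le> (real k * real k) *\<^sub>R p n + c * c * p 0"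
        using c by (intro add_left_mono mult_left_mono decreases_to_zero_mono[OF p]) auto
      finally have "real k *\<^sub>R (c * p n) \<le> (real k * real k) *\<^sub>R p n + c * c * p 0" by simp
      moreover have "real k *\<^sub>R y \<le> real k *\<^sub>R (c * p n)" using y by (intro scaleR_left_mono) auto
      ultimately show ?thesis by (simp add: diff_le_eq)
    qed
    then have bound: "real k *\<^sub>R y - c * c * p 0 \<le> (real k * real k) *\<^sub>R p n" for n .
    show ?thesis
    proof (cases "k = 0")
      case True
      then show ?thesis using c decreases_to_zero_nonneg[OF p] by simp
    next
      case False
      define d where "d = real k * real k"
      have d: "0 < d" using False by (simp add: d_def)
      define l where "l = real k *\<^sub>R y - c * c * p 0"
      have "inverse d *\<^sub>R l \<le> p n" for n
        using scaleR_left_mono[OF bound[of n], of "inverse d"] d by (simp flip: d_def l_def)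
      then have "inverse d *\<^sub>R l \<le> 0" by (rule decreases_to_zero_le_imp[OF p])
      then have "d *\<^sub>R (inverse d *\<^sub>R l) \<le> d *\<^sub>R 0"
        using d by (intro scaleR_left_mono) auto
      then have "l \<le> 0" using d by simp
      then show ?thesis by (simp add: l_def)
    qed
  qed
  then show "y \<le> 0" by (rule archimedean_property)
qed

lemma bounded_incseq_decreases_to_zero:
  fixes f :: "nat \<Rightarrow> 'a::{vector_lattice, conditionally_complete_lattice}"
  assumes mono: "incseq f" and bound: "\<And>n. f n \<le> b"
  shows "decreases_to_zero (\<lambda>n. (SUP k. f k) - f n)"
proof (rule decreases_to_zeroI)
  have bdd: "bdd_above (range f)" using bound by (rule bdd_aboveI2)
  have upper: "f n \<le> (SUP k. f k)" for n by (intro cSUP_upper bdd) simp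
  show "decseq (\<lambda>n. (SUP k. f k) - f n)"
    using mono by (auto simp: decseq_def incseq_def)
  show "0 \<le> (SUP k. f k) - f n" for n using upper by simp
  fix y assume "\<And>n. y \<le> (SUP k. f k) - f n"
  then have "f n \<le> (SUP k. f k) - y" for n by (metis add.commute le_diff_eq)
  then have "(SUP k. f k) \<le> (SUP k. f k) - y" by (intro cSUP_least) auto
  then show "y \<le> 0" by simp
qed

text \<open>
  The positive and the negative parts of the terms have increasing bounded partial sums, and
  these converge to their suprema.
\<close>

lemma absolutely_bounded_series_converges:
  fixes x :: "nat \<Rightarrow> 'a::{vector_lattice, conditionally_complete_lattice}"
  assumes bound: "\<And>m. (\<Sum>n\<le>m. \<bar>x n\<bar>) \<le> b"
  shows "\<exists>s p. decreases_to_zero p \<and> (\<forall>m. \<bar>(\<Sum>n\<le>m. x n) - s\<bar> \<le> p m)"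
proof -
  have part: "\<exists>s. decreases_to_zero (\<lambda>m. s - (\<Sum>n\<le>m. y n))"
    if "\<And>n. 0 \<le> y n" "\<And>n. y n \<le> \<bar>x n\<bar>" for y
  proof -
    have "(\<Sum>n\<le>m. y n) \<le> b" for m
      using sum_mono[of "{..m}" y "\<lambda>n. \<bar>x n\<bar>"] that bound order_trans by blast
    moreover have "incseq (\<lambda>m. \<Sum>n\<le>m. y n)" using that by (intro incseq_SucI) simp
    ultimately show ?thesis using bounded_incseq_decreases_to_zero by blast
  qed
  obtain s where s: "decreases_to_zero (\<lambda>m. s - (\<Sum>n\<le>m. pprt (x n)))"
    using part[of "\<lambda>n. pprt (x n)"] by (auto simp: pprt_def abs_ge_self)
  obtain t where t: "decreases_to_zero (\<lambda>m. t - (\<Sum>n\<le>m. pprt (- x n)))"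
    using part[of "\<lambda>n. pprt (- x n)"] by (auto simp: pprt_def abs_ge_minus_self)
  have "\<bar>(\<Sum>n\<le>m. x n) - (s - t)\<bar> \<le> (s - (\<Sum>n\<le>m. pprt (x n))) + (t - (\<Sum>n\<le>m. pprt (- x n)))" for m
  proof -
    have "(\<Sum>n\<le>m. x n) = (\<Sum>n\<le>m. pprt (x n)) - (\<Sum>n\<le>m. pprt (- x n))"
      by (simp only: sum_subtractf[symmetric] pprt_minus_pprt_minus)
    then have eq: "(\<Sum>n\<le>m. x n) - (s - t) =
        (t - (\<Sum>n\<le>m. pprt (- x n))) - (s - (\<Sum>n\<le>m. pprt (x n)))"
      by (simp only:) (simp add: algebra_simps)
    show ?thesis
      unfolding eq using abs_triangle_ineq4[of "t - (\<Sum>n\<le>m. pprt (- x n))" "s - (\<Sum>n\<le>m. pprt (x n))"]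
        decreases_to_zero_nonneg[OF s, of m] decreases_to_zero_nonneg[OF t, of m]
      by (simp add: abs_of_nonneg add.commute)
  qed
  then show ?thesis using decreases_to_zero_add[OF s t] by blast
qed

lemma re_part_sum: "re_part (\<Sum>i\<in>A. f i) = (\<Sum>i\<in>A. re_part (f i))"
  by (induction A rule: infinite_finite_induct)
    (simp_all add: zero_complexification_def plus_complexification_def)

lemma im_part_sum: "im_part (\<Sum>i\<in>A. f i) = (\<Sum>i\<in>A. im_part (f i))"
  by (induction A rule: infinite_finite_induct)
    (simp_all add: zero_complexification_def plus_complexification_def)

lemma absolutely_bounded_order_summable:
  assumes bound: "\<And>m. (\<Sum>n\<le>m. modulus (x n)) \<le> b"
  shows "order_summable x"
proof -
  have "(\<Sum>n\<le>m. \<bar>re_part (x n)\<bar>) \<le> b" for m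
    by (rule order_trans[OF sum_mono[OF abs_re_part_le_modulus] bound])
  then obtain s p where p: "decreases_to_zero p" "\<And>m. \<bar>(\<Sum>n\<le>m. re_part (x n)) - s\<bar> \<le> p m"
    using absolutely_bounded_series_converges[of "\<lambda>n. re_part (x n)" b] by auto
  have "(\<Sum>n\<le>m. \<bar>im_part (x n)\<bar>) \<le> b" for m
    by (rule order_trans[OF sum_mono[OF abs_im_part_le_modulus] bound])
  then obtain t q where q: "decreases_to_zero q" "\<And>m. \<bar>(\<Sum>n\<le>m. im_part (x n)) - t\<bar> \<le> q m"
    using absolutely_bounded_series_converges[of "\<lambda>n. im_part (x n)" b] by auto
  have "modulus ((\<Sum>n\<le>m. x n) - Complexify s t) \<le> p m + q m" for m
    by (rule order_trans[OF modulus_le_abs_add])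
      (use p q in \<open>simp add: minus_complexification_def re_part_sum im_part_sum add_mono\<close>)
  then show ?thesis
    unfolding order_summable_def order_sums_def order_converges_def
    using decreases_to_zero_add[OF p(1) q(1)] by blast
qed

section \<open>Abel's theorem\<close>

text \<open>
  Subtracting \<open>s\<close> from the partial sums of the coefficients makes every factor on the right small
  when \<open>s\<close> is their limit.
\<close>

lemma summation_by_parts_power:
  fixes a :: "nat \<Rightarrow> 'a::{ring, monoid_mult}"
  shows "(\<Sum>n\<le>m. a n * z ^ n) - s =
    (\<Sum>n<m. ((\<Sum>i\<le>n. a i) - s) * z ^ n) * (1 - z) + ((\<Sum>i\<le>m. a i) - s) * z ^ m"
proof (induction m)
  case (Suc m)
  define r where "r = (\<Sum>i\<le>m. a i) - s"
  have "(\<Sum>n\<le>Suc m. a n * z ^ n) - s = ((\<Sum>n\<le>m. a n * z ^ n) - s) + a (Suc m) * z ^ Suc m"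
    by simp
  also have "\<dots> = (\<Sum>n<m. ((\<Sum>i\<le>n. a i) - s) * z ^ n) * (1 - z) + r * z ^ m + a (Suc m) * z ^ Suc m"
    by (simp only: Suc r_def)
  also have "r * z ^ m = r * z ^ m * (1 - z) + r * z ^ Suc m"
    by (simp add: right_diff_distrib mult.assoc power_commutes)
  also have "(\<Sum>n<m. ((\<Sum>i\<le>n. a i) - s) * z ^ n) * (1 - z) + (r * z ^ m * (1 - z) + r * z ^ Suc m)
      + a (Suc m) * z ^ Suc m =
      ((\<Sum>n<m. ((\<Sum>i\<le>n. a i) - s) * z ^ n) + r * z ^ m) * (1 - z) + (r + a (Suc m)) * z ^ Suc m"
    by (simp only: distrib_right add.assoc)
  also have "r + a (Suc m) = (\<Sum>i\<le>Suc m. a i) - s" by (simp add: r_def)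
  also have "(\<Sum>n<m. ((\<Sum>i\<le>n. a i) - s) * z ^ n) + r * z ^ m =
      (\<Sum>n<Suc m. ((\<Sum>i\<le>n. a i) - s) * z ^ n)"
    by (simp add: r_def)
  finally show ?case .
qed simp

text \<open>
  Terms with index below \<open>N\<close> are bounded by \<open>p\<^sub>0\<close> each; they are harmless because of the factor
  \<open>|1 - z|\<close>. Later terms are bounded by \<open>p\<^sub>N |z|\<^sup>n\<close>, and \<open>|1 - z|\<close> times their geometric sum is at
  most \<open>c\<close>.
\<close>

lemma abel_estimate:
  fixes a :: "nat \<Rightarrow> 'a::universally_complete_phi_algebra complexification"
  assumes p: "decreases_to_zero p" "\<And>n. modulus ((\<Sum>i\<le>n. a i) - s) \<le> p n"
    and z: "modulus z \<le> 1"
    and c: "modulus (1 - z) * (\<Sum>n<m. modulus z ^ n) \<le> c"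
  shows "modulus ((\<Sum>n\<le>m. a n * z ^ n) - s) \<le>
    real N *\<^sub>R (p 0 * modulus (1 - z)) + p N * c + p m"
proof -
  define x where "x = modulus z"
  define y where "y = modulus (1 - z)"
  define r where "r n = (\<Sum>i\<le>n. a i) - s" for n
  have xy: "0 \<le> x" "x \<le> 1" "0 \<le> y" using z by (simp_all add: x_def y_def modulus_nonneg)
  have pow: "0 \<le> x ^ n" "x ^ n \<le> 1" for n using power_nonneg_le_one[OF xy(1,2)] by auto
  have p0: "0 \<le> p n" for n by (rule decreases_to_zero_nonneg[OF p(1)])
  have term_le: "modulus (r n * z ^ n) \<le> p n * x ^ n" for n
    by (rule order_trans[OF modulus_mult_le])
      (use p(2) p0 modulus_power_le in \<open>auto simp: r_def x_def modulus_nonneg intro!: mult_mono\<close>)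
  have split: "p n * x ^ n \<le> (if n < N then p 0 else 0) + p N * x ^ n" for n
  proof (cases "n < N")
    case True
    have "p n * x ^ n \<le> p 0 * 1"
      using p0 pow decreases_to_zero_mono[OF p(1)] by (intro mult_mono) auto
    moreover have "0 \<le> p N * x ^ n" using p0 pow by simp
    ultimately show ?thesis using True by (simp add: add_increasing2)
  next
    case False
    then show ?thesis
      using pow decreases_to_zero_mono[OF p(1), of N n] by (simp add: mult_right_mono)
  qed
  have "(\<Sum>n<m. if n < N then p 0 else 0) \<le> real N *\<^sub>R p 0"
  proof -
    have "(\<Sum>n<m. if n < N then p 0 else 0) = real (card ({..<m} \<inter> {..<N})) *\<^sub>R p 0"
      by (simp add: sum.If_cases sum_constant_scaleR lessThan_def)
    also have "\<dots> \<le> real N *\<^sub>R p 0"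
      using card_mono[of "{..<N}" "{..<m} \<inter> {..<N}"] p0 by (intro scaleR_right_mono) auto
    finally show ?thesis .
  qed
  have "modulus (\<Sum>n<m. r n * z ^ n) \<le> (\<Sum>n<m. modulus (r n * z ^ n))" by (rule modulus_sum_le)
  also have "\<dots> \<le> (\<Sum>n<m. (if n < N then p 0 else 0) + p N * x ^ n)"
    by (intro sum_mono order_trans[OF term_le split])
  also have "\<dots> = (\<Sum>n<m. if n < N then p 0 else 0) + p N * (\<Sum>n<m. x ^ n)"
    by (simp only: sum.distrib sum_distrib_left)
  also have "\<dots> \<le> real N *\<^sub>R p 0 + p N * (\<Sum>n<m. x ^ n)" by (intro add_right_mono) fact
  finally have head: "modulus (\<Sum>n<m. r n * z ^ n) \<le> real N *\<^sub>R p 0 + p N * (\<Sum>n<m. x ^ n)" .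
  have "(\<Sum>n\<le>m. a n * z ^ n) - s = (\<Sum>n<m. r n * z ^ n) * (1 - z) + r m * z ^ m"
    unfolding r_def by (rule summation_by_parts_power)
  then have "modulus ((\<Sum>n\<le>m. a n * z ^ n) - s) \<le>
      modulus ((\<Sum>n<m. r n * z ^ n) * (1 - z)) + modulus (r m * z ^ m)"
    by (simp only: modulus_add_le)
  also have "\<dots> \<le> modulus (\<Sum>n<m. r n * z ^ n) * y + p m * x ^ m"
    unfolding y_def by (intro add_mono modulus_mult_le term_le)
  also have "\<dots> \<le> (real N *\<^sub>R p 0 + p N * (\<Sum>n<m. x ^ n)) * y + p m * 1"
    using xy p0 pow by (intro add_mono mult_right_mono mult_left_mono head)
  also have "\<dots> = real N *\<^sub>R (p 0 * y) + p N * (y * (\<Sum>n<m. x ^ n)) + p m"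
    by (simp add: distrib_left phi_algebra_ac)
  also have "\<dots> \<le> real N *\<^sub>R (p 0 * y) + p N * c + p m"
    using c p0 unfolding x_def y_def by (intro add_mono mult_left_mono) auto
  finally show ?thesis by (simp only: y_def)
qed

theorem proposition3p12:
  fixes a z :: "nat \<Rightarrow> 'a::universally_complete_phi_algebra complexification"
  assumes "has_radius_of_convergence a 0 1"
    and "order_summable a"
    and "order_converges z 1"
    and "\<And>k. modulus (z k) \<lless> 1"
    and "order_bounded (range (\<lambda>k. modulus (1 - z k) * mult_inverse (1 - modulus (z k))))"
  shows "(\<forall>k. order_summable (power_series_term a 0 (z k))) \<and>
    order_summable (power_series_term a 0 1) \<and>
    order_converges (\<lambda>k. power_series a 0 (z k)) (power_series a 0 1)"
proof -
  have term_eq: "power_series_term a 0 w = (\<lambda>n. a n * w ^ n)" for w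
    by (simp add: power_series_term_def fun_eq_iff)
  have term_one: "power_series_term a 0 1 = a" by (simp add: term_eq)
  obtain s where s: "order_sums a s" using assms(2) by (auto simp: order_summable_def)
  obtain p where p: "decreases_to_zero p" "\<And>n. modulus ((\<Sum>i\<le>n. a i) - s) \<le> p n"
    using s by (auto simp: order_sums_def order_converges_def)
  obtain q where q: "decreases_to_zero q" "\<And>k. modulus (z k - 1) \<le> q k"
    using assms(3) by (auto simp: order_converges_def)
  have p0: "0 \<le> p n" for n by (rule decreases_to_zero_nonneg[OF p(1)])
  have z_le: "modulus (z k) \<le> 1" for k by (rule much_less_one(1)[OF assms(4)])
  obtain v where v: "\<And>k. (1 - modulus (z k)) * v k = 1" "\<And>k. v k * (1 - modulus (z k)) = 1"
      "\<And>k m. (\<Sum>i<m. modulus (z k) ^ i) \<le> v k"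
    using one_minus_invertible[OF modulus_nonneg z_le much_less_one(2)[OF assms(4)]] by metis
  obtain c where c: "\<And>k. modulus (1 - z k) * v k \<le> c"
    using assms(5) by (auto simp: order_bounded_def bdd_above_def mult_inverse_eq[OF v(1,2)])
  have c0: "0 \<le> c"
  proof -
    have "0 \<le> v 0" using v(3)[where m = 0 and k = 0] by simp
    then show ?thesis using c[of 0] modulus_nonneg by (meson mult_nonneg_nonneg order_trans)
  qed

  \<comment> \<open>The coefficients are bounded, so the series is dominated by a multiple of a geometric series.\<close>
  have summable: "order_summable (power_series_term a 0 (z k))" for k
  proof -
    define b where "b = p 0 + p 0 + modulus s"
    have a_le: "modulus (a n) \<le> b" for n
    proof (cases n)
      case 0
      have "modulus (a 0) \<le> modulus ((\<Sum>i\<le>0. a i) - s) + modulus s"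
        using modulus_add_le[of "a 0 - s" s] by simp
      also have "\<dots> \<le> p 0 + modulus s" by (intro add_right_mono p(2))
      also have "\<dots> \<le> b" by (simp add: b_def p0)
      finally show ?thesis by (simp only: 0)
    next
      case (Suc m)
      have "a n = ((\<Sum>i\<le>n. a i) - s) + - ((\<Sum>i\<le>m. a i) - s)" by (simp add: Suc)
      then have "modulus (a n) \<le> modulus ((\<Sum>i\<le>n. a i) - s) + modulus ((\<Sum>i\<le>m. a i) - s)"
        by (metis modulus_add_le modulus_minus)
      also have "\<dots> \<le> p 0 + p 0"
        by (intro add_mono order_trans[OF p(2)] decreases_to_zero_mono[OF p(1)] le0)
      also have "\<dots> \<le> b" by (simp add: b_def modulus_nonneg)
      finally show ?thesis .
    qed
    have b0: "0 \<le> b" using a_le[of 0] modulus_nonneg order_trans by blast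
    have "(\<Sum>n\<le>m. modulus (a n * z k ^ n)) \<le> b * v k" for m
    proof -
      have "modulus (a n * z k ^ n) \<le> b * modulus (z k) ^ n" for n
        by (rule order_trans[OF modulus_mult_le])
          (use a_le b0 modulus_power_le in \<open>auto simp: modulus_nonneg intro!: mult_mono\<close>)
      then have "(\<Sum>n\<le>m. modulus (a n * z k ^ n)) \<le> (\<Sum>n\<le>m. b * modulus (z k) ^ n)"
        by (intro sum_mono)
      also have "\<dots> = b * (\<Sum>n<Suc m. modulus (z k) ^ n)"
        by (simp only: sum_distrib_left lessThan_Suc_atMost)
      also have "\<dots> \<le> b * v k" using b0 v(3) by (rule mult_left_mono[rotated])
      finally show ?thesis .
    qed
    then show ?thesis unfolding term_eq by (rule absolutely_bounded_order_summable)
  qed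

  have estimate: "modulus (power_series a 0 (z k) - s) \<le> (real N *\<^sub>R p 0) * q k + c * p N" for k N
  proof -
    define S where "S = power_series a 0 (z k)"
    obtain t where t: "decreases_to_zero t" "\<And>m. modulus ((\<Sum>n\<le>m. a n * z k ^ n) - S) \<le> t m"
      using summable[of k] order_suminf_eq
      unfolding S_def power_series_def order_summable_def order_sums_def order_converges_def term_eq
      by (metis (no_types, lifting) order_converges_def order_sums_def)
    \<comment> \<open>Compare with the partial sum of index \<open>m\<close>; both errors that depend on \<open>m\<close> decrease to zero.\<close>
    have "modulus (S - s) - ((real N *\<^sub>R p 0) * q k + c * p N) \<le> t m + p m" for m
    proof -
      define P where "P = (\<Sum>n\<le>m. a n * z k ^ n)"
      have "modulus (1 - z k) * (\<Sum>n<m. modulus (z k) ^ n) \<le> c"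
        using c mult_left_mono[OF v(3) modulus_nonneg] order_trans by blast
      then have "modulus (P - s) \<le> real N *\<^sub>R (p 0 * modulus (1 - z k)) + p N * c + p m"
        unfolding P_def by (rule abel_estimate[OF p z_le])
      also have "\<dots> \<le> real N *\<^sub>R (p 0 * q k) + p N * c + p m"
        using q(2)[of k] p0 by (intro add_right_mono scaleR_left_mono mult_left_mono)
          (simp_all add: modulus_diff_commute)
      finally have Ps: "modulus (P - s) \<le> (real N *\<^sub>R p 0) * q k + c * p N + p m"
        by (simp add: phi_algebra_commute[of "p N"])
      have "modulus (S - s) \<le> modulus (S - P) + modulus (P - s)"
        using modulus_add_le[of "S - P" "P - s"] by simp
      also have "\<dots> \<le> t m + ((real N *\<^sub>R p 0) * q k + c * p N + p m)"
        using t(2)[of m] Ps by (intro add_mono) (simp_all add: P_def modulus_diff_commute)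
      finally show ?thesis by (simp add: diff_le_eq add_ac)
    qed
    then have "modulus (S - s) - ((real N *\<^sub>R p 0) * q k + c * p N) \<le> 0"
      by (rule decreases_to_zero_add_le[OF t(1) p(1)])
    then show ?thesis by (simp add: S_def)
  qed

  \<comment> \<open>A single null sequence is needed: take the best choice of \<open>N\<close> for each \<open>k\<close>.\<close>
  define r where "r k = (INF N. (real N *\<^sub>R p 0) * q k + c * p N)" for k
  have q0: "0 \<le> q k" for k by (rule decreases_to_zero_nonneg[OF q(1)])
  have nonneg: "0 \<le> (real N *\<^sub>R p 0) * q k + c * p N" for k N
    using p0 q0 c0 by (simp add: scaleR_nonneg_nonneg)
  have r_le: "r k \<le> (real N *\<^sub>R p 0) * q k + c * p N" for k N
    unfolding r_def by (rule cINF_lower[OF bdd_belowI2[OF nonneg]]) simp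
  have r: "decreases_to_zero r"
  proof (rule decreases_to_zeroI)
    show "0 \<le> r k" for k unfolding r_def by (intro cINF_greatest nonneg) auto
    show "decseq r"
    proof (rule decseq_SucI)
      fix k
      have "r (Suc k) \<le> (real N *\<^sub>R p 0) * q k + c * p N" for N
        by (rule order_trans[OF r_le[of _ N]])
          (use p0 decreases_to_zero_mono[OF q(1), of k "Suc k"] in
            \<open>simp add: mult_left_mono scaleR_left_mono\<close>)
      then show "r (Suc k) \<le> r k" unfolding r_def[of k] by (intro cINF_greatest) auto
    qed
    fix y assume y: "\<And>k. y \<le> r k"
    have "y \<le> c * p N" for N
    proof -
      have "y - c * p N \<le> (real N *\<^sub>R p 0) * q k" for k
        using order_trans[OF y r_le] by (simp add: diff_le_eq)
      then have "y - c * p N \<le> 0"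
        by (rule decreases_to_zero_le_imp[OF decreases_to_zero_mult_left[OF q(1)], rotated])
          (use p0 in \<open>simp add: scaleR_nonneg_nonneg\<close>)
      then show ?thesis by simp
    qed
    then show "y \<le> 0"
      by (rule decreases_to_zero_le_imp[OF decreases_to_zero_mult_left[OF p(1) c0]])
  qed
  have "modulus (power_series a 0 (z k) - s) \<le> r k" for k
    unfolding r_def by (intro cINF_greatest estimate) auto
  with r have "order_converges (\<lambda>k. power_series a 0 (z k)) s"
    unfolding order_converges_def by blast
  moreover have "power_series a 0 1 = s"
    unfolding power_series_def term_one by (rule order_suminf_eq[OF s])
  ultimately show ?thesis using summable assms(2) by (simp add: term_one)
qed

end
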